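(* Let $a,b,c$ be positive integers with $b\le c$. Consider the uniform measure on tilings of the $(a,b,c)$-hexagon by lozenges, equivalently the uniform measure on the families of $a$ non-intersecting $\pm1$ walks described in the context. The blue dots (the points of $\Lambda_{a,b,c}$ not visited by the walks) form a determinantal point process on the space $\Lambda_{a,b,c}$ with the following kernel, where $(r,x)$, $0\le r\le b+c$, $0\le x\le\gamma_r$, stands for the point $(r,\alpha_r+2x)\in\Lambda_{a,b,c}$, and similarly $(s,y)$ stands for $(s,\alpha_s+2y)$. When $s\ge r$, $$K(r,x;s,y)=\sum_{n=-\infty}^{-1}\sqrt{\frac{(s+n)!\,(b+c-r+n)!}{(r+n)!\,(b+c-s+n)!}}\;q^{(b_r,a_r)}_{r+n,\gamma_r}(x)\,q^{(b_s,a_s)}_{s+n,\gamma_s}(y)\sqrt{w^{(b_r,a_r)}_{\gamma_r}(x)\,w^{(b_s,a_s)}_{\gamma_s}(y)},$$ and otherwise (when $s<r$), $$K(r,x;s,y)=-\sum_{n=0}^{a-1}\sqrt{\frac{(s+n)!\,(b+c-r+n)!}{(r+n)!\,(b+c-s+n)!}}\;q^{(b_r,a_r)}_{r+n,\gamma_r}(x)\,q^{(b_s,a_s)}_{s+n,\gamma_s}(y)\sqrt{w^{(b_r,a_r)}_{\gamma_r}(x)\,w^{(b_s,a_s)}_{\gamma_s}(y)}.$$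
   Context: Setting: $a$ walkers start at time $t=0$ at $y=0,2,\dots,2a-2$; in each unit of time each moves one unit up or down; they end at $y=c-b,c-b+2,\dots,c-b+2a-2$ at time $t=b+c$; they never intersect. All such families of paths are equally likely; they are in bijection with tilings of the hexagon with side lengths $a,b,c,a,b,c$ by lozenges (rhombi of side length $1$ with angles $\pi/3$ and $2\pi/3$). Define $$\gamma_t=\begin{cases}t+a-1&0\le t\le b\\ b+a-1&b\le t\le c\\ a+b+c-t-1&c\le t\le b+c,\end{cases}\qquad \alpha_t=\begin{cases}-t&0\le t\le b\\ t-2b&b\le t\le b+c,\end{cases}$$ $a_r=|c-r|$, $b_r=|b-r|$, and $\Lambda_{a,b,c}=\{(t,\alpha_t+2k):0\le t\le b+c,\ 0\le k\le\gamma_t\}$ ($t,k$ integers). Red dots are the points $(t,y)\in\Lambda_{a,b,c}$ occupied by a walker at time $t$; blue dots are all other points of $\Lambda_{a,b,c}$. Normalised Hahn polynomials: $q^{(\alpha,\beta)}_{n,N}$ is the polynomial of degree $n$, with sign fixed by $q^{(\alpha,\beta)}_{n,N}(0)>0$, in the family satisfying $$\sum_{x=0}^N q^{(\alpha,\beta)}_{n,N}(x)\,q^{(\alpha,\beta)}_{m,N}(x)\,w^{(\alpha,\beta)}_N(x)=\delta_{m,n},\qquad w^{(\alpha,\beta)}_N(t)=\frac{(N+\alpha-t)!\,(\beta+t)!}{t!\,(N-t)!}.$$ Any term containing a polynomial of negative index is $0$ (so the first sum is finite). A point process on the finite set $\Lambda_{a,b,c}$ (with counting measure) is determinantal with kernel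 $K$ if for all $n$ and all distinct points $p_1,\dots,p_n$, the probability that all of $p_1,\dots,p_n$ belong to the process equals $\det[K(p_i;p_j)]_{1\le i,j\le n}$.
   Formalization: Corrected kernel: Hahn parameters are (a_r,b_r),(a_s,b_s) instead of (b_r,a_r),(b_s,a_s), and degrees are γ_r+1−a+n, γ_s+1−a+n instead of r+n, s+n (equal for r,s≤b); for a=b=1, c=2 the printed kernel gives 1/3 instead of 2/3 at (1,−1). *)

theory Defs
  imports
    "HOL-Probability.Probability_Mass_Function"
    "HOL-Analysis.Infinite_Sum"
    "HOL-Computational_Algebra.Polynomial"
    "Jordan_Normal_Form.Determinant"
begin

definition determinantal_process :: "'a set \<Rightarrow> 'a set pmf \<Rightarrow> ('a \<Rightarrow> 'a \<Rightarrow> real) \<Rightarrow> bool" where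
  "determinantal_process L P K \<longleftrightarrow>
     finite L \<and> (\<forall>X\<in>set_pmf P. X \<subseteq> L) \<and>
     (\<forall>ps. distinct ps \<and> set ps \<subseteq> L \<longrightarrow>
        measure_pmf.prob P {X. set ps \<subseteq> X} =
        Determinant.det (Matrix.mat (length ps) (length ps) (\<lambda>(i, j). K (ps ! i) (ps ! j))))"

text \<open>Walker \<open>i\<close> is at height \<open>w i t\<close> at time \<open>t\<close>.  Non-intersecting \<open>\<plusminus>1\<close> walkers
  starting at heights of equal parity keep their order, so the \<open>i\<close>-th walker necessarily ends at
  the \<open>i\<close>-th end point.  Extensionality makes the set of families finite.\<close>

definition walk_families :: "nat \<Rightarrow> nat \<Rightarrow> nat \<Rightarrow> (nat \<Rightarrow> nat \<Rightarrow> int) set" where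
  "walk_families a b c =
     {w \<in> {..<a} \<rightarrow>\<^sub>E ({..b + c} \<rightarrow>\<^sub>E UNIV).
        (\<forall>i<a. w i 0 = 2 * int i) \<and>
        (\<forall>i<a. w i (b + c) = int c - int b + 2 * int i) \<and>
        (\<forall>i<a. \<forall>t<b + c. w i (Suc t) = w i t + 1 \<or> w i (Suc t) = w i t - 1) \<and>
        (\<forall>i<a. \<forall>j<a. \<forall>t\<le>b + c. i \<noteq> j \<longrightarrow> w i t \<noteq> w j t)}"

definition gamma_line :: "nat \<Rightarrow> nat \<Rightarrow> nat \<Rightarrow> nat \<Rightarrow> nat" where
  "gamma_line a b c t =
     (if t \<le> b then t + a - 1 else if t \<le> c then b + a - 1 else a + b + c - t - 1)"

definition alpha_line :: "nat \<Rightarrow> nat \<Rightarrow> int" where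
  "alpha_line b t = (if t \<le> b then - int t else int t - 2 * int b)"

definition Lambda_set :: "nat \<Rightarrow> nat \<Rightarrow> nat \<Rightarrow> (nat \<times> int) set" where
  "Lambda_set a b c =
     {(t, alpha_line b t + 2 * int k) | t k. t \<le> b + c \<and> k \<le> gamma_line a b c t}"

definition red_dots :: "nat \<Rightarrow> nat \<Rightarrow> nat \<Rightarrow> (nat \<Rightarrow> nat \<Rightarrow> int) \<Rightarrow> (nat \<times> int) set" where
  "red_dots a b c w = {(t, y) \<in> Lambda_set a b c. \<exists>i<a. w i t = y}"

definition blue_dots :: "nat \<Rightarrow> nat \<Rightarrow> nat \<Rightarrow> (nat \<Rightarrow> nat \<Rightarrow> int) \<Rightarrow> (nat \<times> int) set" where
  "blue_dots a b c w = Lambda_set a b c - red_dots a b c w"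

definition blue_process :: "nat \<Rightarrow> nat \<Rightarrow> nat \<Rightarrow> (nat \<times> int) set pmf" where
  "blue_process a b c = map_pmf (blue_dots a b c) (pmf_of_set (walk_families a b c))"

definition hahn_weight :: "nat \<Rightarrow> nat \<Rightarrow> nat \<Rightarrow> nat \<Rightarrow> real" where
  "hahn_weight \<alpha> \<beta> N t = fact (N + \<alpha> - t) * fact (\<beta> + t) / (fact t * fact (N - t))"

definition is_hahn_family :: "nat \<Rightarrow> nat \<Rightarrow> nat \<Rightarrow> (nat \<Rightarrow> real poly) \<Rightarrow> bool" where
  "is_hahn_family \<alpha> \<beta> N q \<longleftrightarrow>
     (\<forall>n\<le>N. degree (q n) = n \<and> poly (q n) 0 > 0) \<and>
     (\<forall>n\<le>N. \<forall>m\<le>N.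
        (\<Sum>x=0..N. poly (q n) (real x) * poly (q m) (real x) * hahn_weight \<alpha> \<beta> N x) =
        (if m = n then 1 else 0))"

text \<open>The conditions determine \<open>q n\<close> uniquely for \<open>n \<le> N\<close>, and there is no such polynomial for
  \<open>n > N\<close>; the kernel below only uses degrees up to \<open>N\<close>.\<close>

definition hahn_poly :: "nat \<Rightarrow> nat \<Rightarrow> nat \<Rightarrow> nat \<Rightarrow> real poly" where
  "hahn_poly \<alpha> \<beta> N = (SOME q. is_hahn_family \<alpha> \<beta> N q)"

definition hahn :: "nat \<Rightarrow> nat \<Rightarrow> nat \<Rightarrow> int \<Rightarrow> nat \<Rightarrow> real" where
  "hahn \<alpha> \<beta> N k x = (if k < 0 then 0 else poly (hahn_poly \<alpha> \<beta> N (nat k)) (real x))"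

text \<open>\<open>a_par c r\<close> is \<open>\<bar>c - r\<bar>\<close> and \<open>b_par b r\<close> is \<open>\<bar>b - r\<bar>\<close>.\<close>

definition a_par :: "nat \<Rightarrow> nat \<Rightarrow> nat" where
  "a_par c r = nat \<bar>int c - int r\<bar>"

definition b_par :: "nat \<Rightarrow> nat \<Rightarrow> nat" where
  "b_par b r = nat \<bar>int b - int r\<bar>"

text \<open>Each line \<open>t = r\<close> carries \<open>\<gamma>\<^sub>r + 1\<close> points of the space, \<open>a\<close> of them red; this is the
  number of blue ones.  It equals \<open>r\<close> for \<open>r \<le> b\<close>, then \<open>b\<close> up to \<open>c\<close>, then \<open>b + c - r\<close>.\<close>

definition blue_count :: "nat \<Rightarrow> nat \<Rightarrow> nat \<Rightarrow> nat \<Rightarrow> int" where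
  "blue_count a b c r = int (gamma_line a b c r) + 1 - int a"

text \<open>Two corrections to the kernel as it appears in the literature, where the polynomials are
  \<open>q\<^sub>r\<^sub>+\<^sub>n\<close> with Hahn parameters \<open>(b\<^sub>r, a\<^sub>r)\<close>.
  For \<open>r > b\<close> the index \<open>r + n\<close> is not the right one and may exceed \<open>\<gamma>\<^sub>r\<close>; the blue dots on line
  \<open>r\<close> correspond to the degrees below \<open>blue_count a b c r\<close>, so \<open>r + n\<close> becomes
  \<open>blue_count a b c r + n\<close>, which is the same for \<open>r \<le> b\<close>.
  With \<open>x\<close> counted upwards from the lowest point of line \<open>r\<close>, and the above weight, the parameters
  are \<open>(a\<^sub>r, b\<^sub>r)\<close>: for \<open>a = 1\<close>, \<open>b = 1\<close>, \<open>c = 2\<close> the point \<open>(1, -1)\<close> is blue with probability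
  \<open>2/3\<close>, whereas \<open>(b\<^sub>r, a\<^sub>r)\<close> would give \<open>1/3\<close>.

  If neither polynomial has a negative index, all four factorials have nonnegative arguments, so
  \<open>nat\<close> only truncates in terms that vanish.\<close>

definition kernel_term ::
    "nat \<Rightarrow> nat \<Rightarrow> nat \<Rightarrow> int \<Rightarrow> nat \<Rightarrow> nat \<Rightarrow> nat \<Rightarrow> nat \<Rightarrow> real" where
  "kernel_term a b c n r x s y =
     sqrt (fact (nat (int s + n)) * fact (nat (int b + int c - int r + n)) /
           (fact (nat (int r + n)) * fact (nat (int b + int c - int s + n)))) *
     hahn (a_par c r) (b_par b r) (gamma_line a b c r) (blue_count a b c r + n) x *
     hahn (a_par c s) (b_par b s) (gamma_line a b c s) (blue_count a b c s + n) y *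
     sqrt (hahn_weight (a_par c r) (b_par b r) (gamma_line a b c r) x *
           hahn_weight (a_par c s) (b_par b s) (gamma_line a b c s) y)"

definition blue_kernel :: "nat \<Rightarrow> nat \<Rightarrow> nat \<Rightarrow> nat \<Rightarrow> nat \<Rightarrow> nat \<Rightarrow> nat \<Rightarrow> real" where
  "blue_kernel a b c r x s y =
     (if r \<le> s then (\<Sum>\<^sub>\<infinity>n\<in>{..-1}. kernel_term a b c n r x s y)
      else - (\<Sum>n = 0..int a - 1. kernel_term a b c n r x s y))"

end

theory Submission
  imports Defs
begin

text \<open>All points of a set \<open>S\<close> are blue exactly when no walker visits \<open>S\<close>. By the theorem of Karlin and
McGregor, the number of families of non-intersecting walks inside a set \<open>A\<close> is the determinant of
the numbers of single paths inside \<open>A\<close> between the start and end points (\<open>karlin_mcgregor\<close>).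
So the probability in question is \<open>det M(\<Lambda> - S) / det M(\<Lambda>)\<close>, where \<open>M(A)\<close> is that matrix.

Let \<open>G(p, q)\<close> be the number of paths in \<open>\<Lambda>\<close> from \<open>p\<close> to \<open>q\<close>. Splitting a path at its first visit
to \<open>S\<close> (\<open>paths_in_first_hit\<close>) relates \<open>M(\<Lambda> - S)\<close> to \<open>M(\<Lambda>)\<close>, and two factorisations of one bordered
matrix (\<open>det_bordered\<close>) turn the quotient into the determinant over \<open>S\<close> of
\<open>G(p, q) - \<Sum>\<^sub>i\<^sub>j G(p, e\<^sub>j) (M\<^sup>-\<^sup>1)\<^sub>j\<^sub>i G(s\<^sub>i, q)\<close> with start points \<open>s\<^sub>i\<close> and end points \<open>e\<^sub>j\<close>.

The Hahn polynomials make this explicit. On the line \<open>t = r\<close> the Hahn polynomials times the square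
root of their weight form an orthonormal basis of the functions on that line. Number its elements
by \<open>n\<close>, the degree minus the number of blue dots on the line, so that \<open>n \<le> a - 1\<close>. After
multiplication by suitable functions of the points (\<open>gauge\<close>), one step of the walk maps the \<open>n\<close>-th
basis function of a line to a multiple of the \<open>n\<close>-th of the next line, since a step is one of the
ladder operators of the Hahn polynomials: it raises the degree by one for \<open>r < b\<close>, keeps it for
\<open>b \<le> r < c\<close> and lowers it by one for \<open>r \<ge> c\<close>, just as the number of blue dots changes
(\<open>right_fun_step\<close>). Hence \<open>G(p, q) = \<Sum>\<^sub>n left\<^sub>n(p) right\<^sub>n(q)\<close> whenever \<open>q\<close> is not earlier than \<open>p\<close>
(\<open>paths_expansion\<close>). The first and last line carry no blue dots, so only \<open>0 \<le> n < a\<close> occurs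
in \<open>M\<close>, and the subtracted double sum is \<open>\<Sum>\<^sub>n left\<^sub>n(p) right\<^sub>n(q)\<close> over \<open>0 \<le> n < a\<close> for all \<open>p\<close> and \<open>q\<close>.
What is left is the sum over \<open>n < 0\<close> if \<open>G(p, q)\<close> is given by the expansion, and minus the sum over
\<open>0 \<le> n < a\<close> if \<open>q\<close> is earlier than \<open>p\<close>, where \<open>G(p, q) = 0\<close>. Up to conjugation by \<open>gauge\<close>, which
does not change determinants, this is the kernel.\<close>

section \<open>Ladder operators for the Hahn weights\<close>

text \<open>A translation by \<open>c\<close> changes \<open>x\<^sup>k\<close> by \<open>c k x\<^sup>k\<^sup>-\<^sup>1\<close> plus lower terms. The leading coefficients of all
the operators below reduce to this.\<close>

lemma shift_difference_coeff:
  fixes p :: "real poly"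
  assumes "degree p \<le> Suc m"
  shows "degree (p \<circ>\<^sub>p [:c, 1:] - p) \<le> m"
    and "coeff (p \<circ>\<^sub>p [:c, 1:] - p) m = c * real (Suc m) * coeff p (Suc m)"
proof -
  have "degree (p \<circ>\<^sub>p [:c, 1:] - p) \<le> m \<and>
        coeff (p \<circ>\<^sub>p [:c, 1:] - p) m = c * real (Suc m) * coeff p (Suc m)"
    using assms
  proof (induction m arbitrary: p)
    case 0
    obtain a q where p: "p = pCons a q" by (cases p)
    from 0 have "degree q = 0" by (auto simp: p split: if_splits)
    then obtain d where q: "q = [:d:]" by (auto elim: degree_eq_zeroE)
    show ?case by (simp add: p q pcompose_pCons algebra_simps)
  next
    case (Suc m)
    obtain a q where p: "p = pCons a q" by (cases p)
    let ?d = "q \<circ>\<^sub>p [:c, 1:] - q"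
    have q: "degree q \<le> Suc m" using Suc.prems by (auto simp: p split: if_splits)
    have d: "degree ?d \<le> m" "coeff ?d m = c * real (Suc m) * coeff q (Suc m)"
      using Suc.IH[OF q] by auto
    have eq: "p \<circ>\<^sub>p [:c, 1:] - p = Polynomial.smult c ?d + pCons 0 ?d + Polynomial.smult c q"
      by (simp add: p pcompose_pCons algebra_simps smult_diff_right)
    have "coeff ?d (Suc m) = 0" using d(1) by (intro coeff_eq_0) auto
    then have "coeff (p \<circ>\<^sub>p [:c, 1:] - p) (Suc m) = c * real (Suc (Suc m)) * coeff p (Suc (Suc m))"
      unfolding eq using d(2) by (simp add: p algebra_simps)
    moreover have "degree (p \<circ>\<^sub>p [:c, 1:] - p) \<le> Suc m"
      unfolding eq using d(1) q
      by (intro degree_add_le) (auto intro: order.trans[OF degree_smult_le] order.trans[OF degree_pCons_le])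
    ultimately show ?case by blast
  qed
  then show "degree (p \<circ>\<^sub>p [:c, 1:] - p) \<le> m"
    and "coeff (p \<circ>\<^sub>p [:c, 1:] - p) m = c * real (Suc m) * coeff p (Suc m)" by auto
qed

lemma shift_difference_const:
  fixes p :: "real poly"
  assumes "degree p = 0"
  shows "p \<circ>\<^sub>p [:c, 1:] - p = 0"
  using assms by (auto elim: degree_eq_zeroE)

text \<open>The backward shift operator of the Hahn family. It raises the degree by one and is adjoint to
\<open>hahn_lower\<close>, while the parameters pass from \<open>(\<alpha> + 1, \<beta> + 1, N - 1)\<close> to \<open>(\<alpha>, \<beta>, N)\<close>.\<close>

definition hahn_raise :: "nat \<Rightarrow> nat \<Rightarrow> nat \<Rightarrow> real poly \<Rightarrow> real poly" where
  "hahn_raise \<alpha> \<beta> N p =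
     [:real \<beta> + 1, 1:] * ([:real N, -1:] * p) - [:0, 1:] * ([:real (N + \<alpha>) + 1, -1:] * (p \<circ>\<^sub>p [:-1, 1:]))"

definition hahn_lower :: "real poly \<Rightarrow> real poly" where
  "hahn_lower p = p - p \<circ>\<^sub>p [:1, 1:]"

text \<open>This operator and the next one keep the degree and the interval, and are adjoint to each other;
the first passes from the parameters \<open>(\<alpha>, \<beta>)\<close> to \<open>(\<alpha> - 1, \<beta> + 1)\<close>.\<close>

definition hahn_shift :: "nat \<Rightarrow> nat \<Rightarrow> real poly \<Rightarrow> real poly" where
  "hahn_shift \<alpha> N p = [:real (N + \<alpha>), -1:] * p - [:real N, -1:] * (p \<circ>\<^sub>p [:1, 1:])"

definition hahn_unshift :: "nat \<Rightarrow> real poly \<Rightarrow> real poly" where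
  "hahn_unshift \<beta> p = [:real \<beta> + 1, 1:] * p - [:0, 1:] * (p \<circ>\<^sub>p [:-1, 1:])"

lemma poly_hahn_raise:
  "poly (hahn_raise \<alpha> \<beta> N p) x =
     (real \<beta> + 1 + x) * (real N - x) * poly p x - x * (real (N + \<alpha>) + 1 - x) * poly p (x - 1)"
  by (simp add: hahn_raise_def poly_pcompose algebra_simps)

lemma poly_hahn_lower: "poly (hahn_lower p) x = poly p x - poly p (x + 1)"
  by (simp add: hahn_lower_def poly_pcompose add.commute)

lemma poly_hahn_shift:
  "poly (hahn_shift \<alpha> N p) x = (real (N + \<alpha>) - x) * poly p x - (real N - x) * poly p (x + 1)"
  by (simp add: hahn_shift_def poly_pcompose algebra_simps)

lemma poly_hahn_unshift:
  "poly (hahn_unshift \<beta> p) x = (real \<beta> + 1 + x) * poly p x - x * poly p (x - 1)"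
  by (simp add: hahn_unshift_def poly_pcompose algebra_simps)

lemma degree_linear_mult_le: "degree p \<le> m \<Longrightarrow> degree ([:a, b:] * p) \<le> Suc m" for p :: "real poly"
  by (rule order.trans[OF degree_mult_le]) auto

lemma coeff_linear_mult: "coeff ([:a, b:] * p) (Suc m) = a * coeff p (Suc m) + b * coeff p m"
  for p :: "real poly"
  by simp

text \<open>The two quadratic factors in \<open>hahn_raise\<close> have the same leading term, so the degree only rises by
one; the terms of that degree come from the difference of the factors and from the shift of \<open>p\<close>.\<close>

lemma hahn_raise_coeff:
  assumes "degree p \<le> m"
  shows "degree (hahn_raise \<alpha> \<beta> N p) \<le> Suc m"
    and "coeff (hahn_raise \<alpha> \<beta> N p) (Suc m) = - real (\<alpha> + \<beta> + 2 + m) * coeff p m"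
proof -
  let ?d = "p \<circ>\<^sub>p [:-1, 1:] - p"
  have eq: "hahn_raise \<alpha> \<beta> N p = [:(real \<beta> + 1) * real N, - real (\<alpha> + \<beta> + 2):] * p
      - [:0, 1:] * ([:real (N + \<alpha>) + 1, -1:] * ?d)"
    by (intro poly_ext) (simp add: poly_hahn_raise poly_pcompose, simp add: algebra_simps)
  have p: "coeff p (Suc m) = 0" using assms by (intro coeff_eq_0) auto
  have d1: "degree ([:(real \<beta> + 1) * real N, - real (\<alpha> + \<beta> + 2):] * p) \<le> Suc m"
    using assms by (rule degree_linear_mult_le)
  have "degree (hahn_raise \<alpha> \<beta> N p) \<le> Suc m \<and>
     coeff (hahn_raise \<alpha> \<beta> N p) (Suc m) = - real (\<alpha> + \<beta> + 2 + m) * coeff p m"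
  proof (cases m)
    case 0
    have "?d = 0" by (rule shift_difference_const) (use assms 0 in auto)
    then show ?thesis unfolding eq using d1 p by (simp add: 0)
  next
    case (Suc k)
    note d = shift_difference_coeff[OF assms[unfolded Suc], of "-1"]
    have "degree ([:0, 1:] * ([:real (N + \<alpha>) + 1, -1:] * ?d)) \<le> Suc m"
      unfolding Suc by (intro degree_linear_mult_le d)
    with d1 have "degree (hahn_raise \<alpha> \<beta> N p) \<le> Suc m" unfolding eq by (intro degree_diff_le)
    moreover have "coeff ?d (Suc k) = 0" using d(1) by (intro coeff_eq_0) auto
    then have "coeff (hahn_raise \<alpha> \<beta> N p) (Suc m) = - real (\<alpha> + \<beta> + 2 + m) * coeff p m"
      unfolding eq coeff_diff coeff_linear_mult p using d(2) by (simp only: Suc coeff_linear_mult) (simp add: algebra_simps)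
    ultimately show ?thesis by blast
  qed
  then show "degree (hahn_raise \<alpha> \<beta> N p) \<le> Suc m"
    and "coeff (hahn_raise \<alpha> \<beta> N p) (Suc m) = - real (\<alpha> + \<beta> + 2 + m) * coeff p m" by auto
qed

lemma hahn_lower_coeff:
  assumes "degree p \<le> Suc m"
  shows "degree (hahn_lower p) \<le> m" and "coeff (hahn_lower p) m = - real (Suc m) * coeff p (Suc m)"
proof -
  have eq: "hahn_lower p = - (p \<circ>\<^sub>p [:1, 1:] - p)" by (simp add: hahn_lower_def)
  show "degree (hahn_lower p) \<le> m" unfolding eq degree_minus by (rule shift_difference_coeff[OF assms])
  show "coeff (hahn_lower p) m = - real (Suc m) * coeff p (Suc m)"
    unfolding eq coeff_minus using shift_difference_coeff(2)[OF assms, of 1] by (simp add: algebra_simps)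
qed

lemma hahn_shift_coeff:
  assumes "degree p \<le> m"
  shows "degree (hahn_shift \<alpha> N p) \<le> m"
    and "coeff (hahn_shift \<alpha> N p) m = real (\<alpha> + m) * coeff p m"
proof -
  let ?d = "p \<circ>\<^sub>p [:1, 1:] - p"
  have eq: "hahn_shift \<alpha> N p = Polynomial.smult (real \<alpha>) p - [:real N, -1:] * ?d"
    by (simp add: hahn_shift_def algebra_simps smult_diff_right smult_add_left)
  have "degree (hahn_shift \<alpha> N p) \<le> m \<and> coeff (hahn_shift \<alpha> N p) m = real (\<alpha> + m) * coeff p m"
  proof (cases m)
    case 0
    have "?d = 0" by (rule shift_difference_const) (use assms 0 in auto)
    then show ?thesis unfolding eq using assms by (simp add: 0)
  next
    case (Suc k)
    note d = shift_difference_coeff[OF assms[unfolded Suc], of 1]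
    have "degree (hahn_shift \<alpha> N p) \<le> m" unfolding eq Suc
      using assms Suc by (intro degree_diff_le degree_linear_mult_le[OF d(1)] order.trans[OF degree_smult_le]) auto
    moreover have "coeff ?d (Suc k) = 0" using d(1) by (intro coeff_eq_0) auto
    then have "coeff (hahn_shift \<alpha> N p) m = real (\<alpha> + m) * coeff p m"
      unfolding eq coeff_diff using d(2) by (simp only: Suc coeff_linear_mult) (simp add: algebra_simps)
    ultimately show ?thesis by blast
  qed
  then show "degree (hahn_shift \<alpha> N p) \<le> m"
    and "coeff (hahn_shift \<alpha> N p) m = real (\<alpha> + m) * coeff p m" by auto
qed

lemma hahn_unshift_coeff:
  assumes "degree p \<le> m"
  shows "degree (hahn_unshift \<beta> p) \<le> m"
    and "coeff (hahn_unshift \<beta> p) m = real (\<beta> + 1 + m) * coeff p m"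
proof -
  let ?d = "p \<circ>\<^sub>p [:-1, 1:] - p"
  have eq: "hahn_unshift \<beta> p = Polynomial.smult (real \<beta> + 1) p - [:0, 1:] * ?d"
    by (simp add: hahn_unshift_def algebra_simps smult_diff_right smult_add_left)
  have "degree (hahn_unshift \<beta> p) \<le> m \<and> coeff (hahn_unshift \<beta> p) m = real (\<beta> + 1 + m) * coeff p m"
  proof (cases m)
    case 0
    have "?d = 0" by (rule shift_difference_const) (use assms 0 in auto)
    then show ?thesis unfolding eq using assms by (simp add: 0)
  next
    case (Suc k)
    note d = shift_difference_coeff[OF assms[unfolded Suc], of "-1"]
    have "degree (hahn_unshift \<beta> p) \<le> m" unfolding eq Suc
      using assms Suc by (intro degree_diff_le degree_linear_mult_le[OF d(1)] order.trans[OF degree_smult_le]) auto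
    moreover have "coeff ?d (Suc k) = 0" using d(1) by (intro coeff_eq_0) auto
    then have "coeff (hahn_unshift \<beta> p) m = real (\<beta> + 1 + m) * coeff p m"
      unfolding eq coeff_diff using d(2) by (simp only: Suc coeff_linear_mult) (simp add: algebra_simps)
    ultimately show ?thesis by blast
  qed
  then show "degree (hahn_unshift \<beta> p) \<le> m"
    and "coeff (hahn_unshift \<beta> p) m = real (\<beta> + 1 + m) * coeff p m" by auto
qed

definition hahn_inner :: "nat \<Rightarrow> nat \<Rightarrow> nat \<Rightarrow> real poly \<Rightarrow> real poly \<Rightarrow> real" where
  "hahn_inner \<alpha> \<beta> N p q = (\<Sum>x=0..N. poly p (real x) * poly q (real x) * hahn_weight \<alpha> \<beta> N x)"

lemma hahn_weight_pos: "hahn_weight \<alpha> \<beta> N x > 0"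
  by (simp add: hahn_weight_def)

lemma hahn_inner_commute: "hahn_inner \<alpha> \<beta> N p q = hahn_inner \<alpha> \<beta> N q p"
  by (simp add: hahn_inner_def mult.commute)

lemma hahn_inner_diff_left: "hahn_inner \<alpha> \<beta> N (p - r) q = hahn_inner \<alpha> \<beta> N p q - hahn_inner \<alpha> \<beta> N r q"
  by (simp add: hahn_inner_def algebra_simps sum_subtractf)

lemma hahn_inner_smult_left: "hahn_inner \<alpha> \<beta> N (Polynomial.smult c p) q = c * hahn_inner \<alpha> \<beta> N p q"
  by (simp add: hahn_inner_def sum_distrib_left algebra_simps)

lemma hahn_inner_diff_right: "hahn_inner \<alpha> \<beta> N q (p - r) = hahn_inner \<alpha> \<beta> N q p - hahn_inner \<alpha> \<beta> N q r"
  by (simp add: hahn_inner_def algebra_simps sum_subtractf)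

lemma hahn_inner_smult_right: "hahn_inner \<alpha> \<beta> N q (Polynomial.smult c p) = c * hahn_inner \<alpha> \<beta> N q p"
  by (simp add: hahn_inner_def sum_distrib_left algebra_simps)

lemma hahn_inner_self_eq_0:
  assumes "hahn_inner \<alpha> \<beta> N p p = 0" and "degree p \<le> N"
  shows "p = 0"
proof (rule poly_eqI_degree)
  show "card (real ` {0..N}) > degree p" "card (real ` {0..N}) > degree (0::real poly)"
    using assms(2) by (auto simp: card_image inj_on_def)
  have *: "\<forall>x\<in>{0..N}. poly p (real x) * poly p (real x) * hahn_weight \<alpha> \<beta> N x = 0"
    using assms(1) unfolding hahn_inner_def
    by (subst (asm) sum_nonneg_eq_0_iff) (auto intro!: mult_nonneg_nonneg[OF zero_le_square less_imp_le[OF hahn_weight_pos]])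
  fix x assume "x \<in> real ` {0..N}"
  then obtain i where "i \<in> {0..N}" and x: "x = real i" by blast
  then have "poly p x * poly p x * hahn_weight \<alpha> \<beta> N i = 0" using * by blast
  then show "poly p x = poly 0 x" using hahn_weight_pos[of \<alpha> \<beta> N i] by auto
qed

lemma hahn_inner_self_pos:
  assumes "p \<noteq> 0" and "degree p \<le> N"
  shows "hahn_inner \<alpha> \<beta> N p p > 0"
proof -
  have "hahn_inner \<alpha> \<beta> N p p \<ge> 0" unfolding hahn_inner_def
    by (intro sum_nonneg mult_nonneg_nonneg[OF zero_le_square] less_imp_le[OF hahn_weight_pos])
  then show ?thesis using hahn_inner_self_eq_0[of \<alpha> \<beta> N p] assms by linarith
qed

lemma hahn_weight_raise:
  assumes "x \<le> N"
  shows "hahn_weight \<alpha> \<beta> (Suc N) x * ((real \<beta> + 1 + real x) * (real (Suc N) - real x)) = hahn_weight (Suc \<alpha>) (Suc \<beta>) N x"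
    and "hahn_weight \<alpha> \<beta> (Suc N) (Suc x) * (real (Suc x) * (real (Suc N + \<alpha>) + 1 - real (Suc x))) = hahn_weight (Suc \<alpha>) (Suc \<beta>) N x"
proof -
  obtain k where N: "N = x + k" using assms le_Suc_ex by blast
  show "hahn_weight \<alpha> \<beta> (Suc N) x * ((real \<beta> + 1 + real x) * (real (Suc N) - real x)) = hahn_weight (Suc \<alpha>) (Suc \<beta>) N x"
    by (simp add: hahn_weight_def N divide_simps del: of_nat_Suc, (simp add: algebra_simps)?)
  show "hahn_weight \<alpha> \<beta> (Suc N) (Suc x) * (real (Suc x) * (real (Suc N + \<alpha>) + 1 - real (Suc x))) = hahn_weight (Suc \<alpha>) (Suc \<beta>) N x"
    by (simp add: hahn_weight_def N divide_simps del: of_nat_Suc, (simp add: algebra_simps)?)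
qed

text \<open>Summation by parts. The shifted sums match because both factors of \<open>hahn_raise\<close>, multiplied by the
weight, are the weight with raised parameters; the boundary terms vanish because \<open>Suc N - x\<close> is zero
at the upper end and \<open>x\<close> is zero at the lower end.\<close>

lemma hahn_raise_adjoint:
  "hahn_inner \<alpha> \<beta> (Suc N) (hahn_raise \<alpha> \<beta> (Suc N) p) q =
   hahn_inner (Suc \<alpha>) (Suc \<beta>) N p (hahn_lower q)"
proof -
  let ?w = "hahn_weight \<alpha> \<beta> (Suc N)" and ?v = "hahn_weight (Suc \<alpha>) (Suc \<beta>) N"
  have "hahn_inner \<alpha> \<beta> (Suc N) (hahn_raise \<alpha> \<beta> (Suc N) p) q =
      (\<Sum>x=0..Suc N. ?w x * ((real \<beta> + 1 + real x) * (real (Suc N) - real x)) * poly p (real x) * poly q (real x))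
    - (\<Sum>x=0..Suc N. ?w x * (real x * (real (Suc N + \<alpha>) + 1 - real x)) * poly p (real x - 1) * poly q (real x))"
    unfolding hahn_inner_def poly_hahn_raise sum_subtractf[symmetric] by (intro sum.cong) (auto simp: algebra_simps)
  also have "(\<Sum>x=0..Suc N. ?w x * ((real \<beta> + 1 + real x) * (real (Suc N) - real x)) * poly p (real x) * poly q (real x))
     = (\<Sum>x=0..N. ?v x * poly p (real x) * poly q (real x))"
    by (simp add: sum.atLeast0_atMost_Suc del: of_nat_Suc) (intro sum.cong, auto simp: hahn_weight_raise(1) simp del: of_nat_Suc)
  also have "(\<Sum>x=0..Suc N. ?w x * (real x * (real (Suc N + \<alpha>) + 1 - real x)) * poly p (real x - 1) * poly q (real x))
     = (\<Sum>x=0..N. ?v x * poly p (real x) * poly q (real x + 1))"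
  proof -
    have "(\<Sum>x=0..N. ?w (Suc x) * (real (Suc x) * (real (Suc N + \<alpha>) + 1 - real (Suc x))) * poly p (real (Suc x) - 1) * poly q (real (Suc x)))
       = (\<Sum>x=0..N. ?v x * poly p (real x) * poly q (real x + 1))"
    proof (intro sum.cong refl)
      fix x assume "x \<in> {0..N}"
      then have w: "?w (Suc x) * (real (Suc x) * (real (Suc N + \<alpha>) + 1 - real (Suc x))) = ?v x"
        by (intro hahn_weight_raise(2)) auto
      show "?w (Suc x) * (real (Suc x) * (real (Suc N + \<alpha>) + 1 - real (Suc x))) * poly p (real (Suc x) - 1) * poly q (real (Suc x))
        = ?v x * poly p (real x) * poly q (real x + 1)"
        unfolding w by (simp add: add.commute)
    qed
    then show ?thesis unfolding sum.atLeast0_atMost_Suc_shift by (simp add: comp_def)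
  qed
  finally show ?thesis
    by (simp add: hahn_inner_def poly_hahn_lower sum_subtractf[symmetric] algebra_simps)
qed

lemma hahn_weight_shift:
  assumes "x \<le> N"
  shows "hahn_weight \<alpha> (Suc \<beta>) N x * (real (N + Suc \<alpha>) - real x) = hahn_weight (Suc \<alpha>) \<beta> N x * (real \<beta> + 1 + real x)"
    and "x < N \<Longrightarrow> hahn_weight \<alpha> (Suc \<beta>) N x * (real N - real x) = hahn_weight (Suc \<alpha>) \<beta> N (Suc x) * real (Suc x)"
proof -
  obtain k where N: "N = x + k" using assms le_Suc_ex by blast
  show "hahn_weight \<alpha> (Suc \<beta>) N x * (real (N + Suc \<alpha>) - real x) = hahn_weight (Suc \<alpha>) \<beta> N x * (real \<beta> + 1 + real x)"
    by (simp add: hahn_weight_def N divide_simps del: of_nat_Suc, (simp add: algebra_simps)?)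
  assume "x < N"
  then obtain j where N: "N = x + Suc j" using less_imp_Suc_add by auto
  show "hahn_weight \<alpha> (Suc \<beta>) N x * (real N - real x) = hahn_weight (Suc \<alpha>) \<beta> N (Suc x) * real (Suc x)"
    by (simp add: hahn_weight_def N divide_simps del: of_nat_Suc, (simp add: algebra_simps)?)
qed

lemma hahn_shift_adjoint:
  "hahn_inner \<alpha> (Suc \<beta>) N (hahn_shift (Suc \<alpha>) N p) q = hahn_inner (Suc \<alpha>) \<beta> N p (hahn_unshift \<beta> q)"
proof -
  let ?v = "hahn_weight \<alpha> (Suc \<beta>) N" and ?w = "hahn_weight (Suc \<alpha>) \<beta> N"
  have "hahn_inner \<alpha> (Suc \<beta>) N (hahn_shift (Suc \<alpha>) N p) q =
      (\<Sum>x=0..N. ?v x * (real (N + Suc \<alpha>) - real x) * poly p (real x) * poly q (real x))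
    - (\<Sum>x=0..N. ?v x * (real N - real x) * poly p (real x + 1) * poly q (real x))"
    unfolding hahn_inner_def poly_hahn_shift sum_subtractf[symmetric] by (intro sum.cong) (auto simp: algebra_simps)
  also have "(\<Sum>x=0..N. ?v x * (real (N + Suc \<alpha>) - real x) * poly p (real x) * poly q (real x))
     = (\<Sum>x=0..N. ?w x * (real \<beta> + 1 + real x) * poly p (real x) * poly q (real x))"
    by (intro sum.cong refl arg_cong2[where f="(*)"] hahn_weight_shift(1)) auto
  also have "(\<Sum>x=0..N. ?v x * (real N - real x) * poly p (real x + 1) * poly q (real x))
     = (\<Sum>x=0..N. ?w x * real x * poly p (real x) * poly q (real x - 1))"
  proof (cases N)
    case 0
    then show ?thesis by simp
  next
    case (Suc M)
    have "(\<Sum>x=0..M. ?v x * (real N - real x) * poly p (real x + 1) * poly q (real x))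
      = (\<Sum>x=0..M. ?w (Suc x) * real (Suc x) * poly p (real (Suc x)) * poly q (real (Suc x) - 1))"
      by (intro sum.cong refl arg_cong2[where f="(*)"] hahn_weight_shift(2)) (auto simp: Suc add.commute)
    moreover have "(\<Sum>x=0..Suc M. ?w x * real x * poly p (real x) * poly q (real x - 1)) = 
      (\<Sum>x=0..M. ?w (Suc x) * real (Suc x) * poly p (real (Suc x)) * poly q (real (Suc x) - 1))"
      by (simp only: sum.atLeast0_atMost_Suc_shift) (simp add: comp_def del: of_nat_Suc)
    moreover have "(\<Sum>x=0..Suc M. ?v x * (real N - real x) * poly p (real x + 1) * poly q (real x)) =
      (\<Sum>x=0..M. ?v x * (real N - real x) * poly p (real x + 1) * poly q (real x))"
      by (simp only: sum.atLeast0_atMost_Suc) (simp add: Suc del: of_nat_Suc)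
    ultimately show ?thesis by (simp only: Suc)
  qed
  finally show ?thesis
    by (simp add: hahn_inner_def poly_hahn_unshift sum_subtractf[symmetric] algebra_simps)
qed

section \<open>Hahn polynomials\<close>

text \<open>Low degree is expressed by vanishing coefficients: for \<open>k = 0\<close> this leaves the zero polynomial, so
that inductions on \<open>k\<close> start with a trivial case.\<close>

definition orth_below :: "nat \<Rightarrow> nat \<Rightarrow> nat \<Rightarrow> nat \<Rightarrow> real poly \<Rightarrow> bool" where
  "orth_below \<alpha> \<beta> N k p \<longleftrightarrow> (\<forall>r. (\<forall>i\<ge>k. coeff r i = 0) \<longrightarrow> hahn_inner \<alpha> \<beta> N p r = 0)"

text \<open>The difference has degree below \<open>k\<close> and is orthogonal to itself, and a polynomial of degree at most
\<open>N\<close> that vanishes on the \<open>N + 1\<close> points of the interval is zero.\<close>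

lemma orth_below_unique:
  assumes "k \<le> N" and "degree p \<le> k" and "degree q \<le> k" and "coeff q k \<noteq> 0"
    and "orth_below \<alpha> \<beta> N k p" and "orth_below \<alpha> \<beta> N k q"
  shows "p = Polynomial.smult (coeff p k / coeff q k) q"
proof -
  let ?d = "p - Polynomial.smult (coeff p k / coeff q k) q"
  have low: "\<forall>i\<ge>k. coeff ?d i = 0"
  proof (intro allI impI)
    fix i assume "k \<le> i"
    then show "coeff ?d i = 0" using assms(2-4)
      by (cases "i = k") (auto simp: coeff_eq_0)
  qed
  then have "hahn_inner \<alpha> \<beta> N p ?d = 0" "hahn_inner \<alpha> \<beta> N q ?d = 0"
    using assms(5,6) unfolding orth_below_def by blast+
  then have "hahn_inner \<alpha> \<beta> N ?d ?d = 0"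
    by (simp only: hahn_inner_diff_left hahn_inner_smult_left)
  moreover have "degree ?d \<le> N" by (rule degree_le) (meson low assms(1) less_imp_le order.trans)
  ultimately have "?d = 0" by (rule hahn_inner_self_eq_0)
  then show ?thesis by (rule eq_iff_diff_eq_0[THEN iffD2])
qed

lemma hahn_raise_orth:
  assumes "orth_below (Suc \<alpha>) (Suc \<beta>) N k p"
  shows "orth_below \<alpha> \<beta> (Suc N) (Suc k) (hahn_raise \<alpha> \<beta> (Suc N) p)"
  unfolding orth_below_def
proof (intro allI impI)
  fix r :: "real poly" assume r: "\<forall>i\<ge>Suc k. coeff r i = 0"
  have "\<forall>i\<ge>k. coeff (hahn_lower r) i = 0"
  proof (intro allI impI)
    fix i assume i: "k \<le> i"
    have "degree r \<le> k" using r by (intro degree_le) auto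
    then have "degree r \<le> Suc i" using i by simp
    from hahn_lower_coeff(2)[OF this] show "coeff (hahn_lower r) i = 0" using r i by simp
  qed
  then show "hahn_inner \<alpha> \<beta> (Suc N) (hahn_raise \<alpha> \<beta> (Suc N) p) r = 0"
    unfolding hahn_raise_adjoint using assms unfolding orth_below_def by blast
qed

text \<open>Rodrigues' formula for unnormalised Hahn polynomials. It yields their existence, and it shows at
once the sign at \<open>0\<close> (which \<open>hahn_raise\<close> keeps) and the sign of the leading coefficient (which
\<open>hahn_raise\<close> flips).\<close>

fun hahn_rodrigues :: "nat \<Rightarrow> nat \<Rightarrow> nat \<Rightarrow> nat \<Rightarrow> real poly" where
  "hahn_rodrigues \<alpha> \<beta> N 0 = 1"
| "hahn_rodrigues \<alpha> \<beta> N (Suc k) = hahn_raise \<alpha> \<beta> N (hahn_rodrigues (Suc \<alpha>) (Suc \<beta>) (N - 1) k)"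

lemma hahn_rodrigues_props:
  assumes "k \<le> N"
  shows "degree (hahn_rodrigues \<alpha> \<beta> N k) = k"
    and "(-1) ^ k * coeff (hahn_rodrigues \<alpha> \<beta> N k) k > 0"
    and "poly (hahn_rodrigues \<alpha> \<beta> N k) 0 > 0"
    and "orth_below \<alpha> \<beta> N k (hahn_rodrigues \<alpha> \<beta> N k)"
proof -
  have "degree (hahn_rodrigues \<alpha> \<beta> N k) \<le> k \<and> (-1) ^ k * coeff (hahn_rodrigues \<alpha> \<beta> N k) k > 0 \<and>
    poly (hahn_rodrigues \<alpha> \<beta> N k) 0 > 0 \<and> orth_below \<alpha> \<beta> N k (hahn_rodrigues \<alpha> \<beta> N k)"
    using assms
  proof (induction k arbitrary: \<alpha> \<beta> N)
    case 0
    have "hahn_inner \<alpha> \<beta> N 1 r = 0" if "\<forall>i. coeff r i = 0" for r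
      using that by (simp add: poly_eq_iff[symmetric, of r 0, simplified] hahn_inner_def)
    then show ?case by (auto simp: orth_below_def)
  next
    case (Suc k)
    then obtain M where N: "N = Suc M" "k \<le> M" by (cases N) auto
    let ?p = "hahn_rodrigues (Suc \<alpha>) (Suc \<beta>) M k"
    note IH = Suc.IH[OF N(2), of "Suc \<alpha>" "Suc \<beta>"]
    have c: "coeff (hahn_raise \<alpha> \<beta> N ?p) (Suc k) = - real (\<alpha> + \<beta> + 2 + k) * coeff ?p k"
      using IH by (intro hahn_raise_coeff(2)) simp
    have "(-1) ^ Suc k * coeff (hahn_raise \<alpha> \<beta> N ?p) (Suc k) = real (\<alpha> + \<beta> + 2 + k) * ((-1) ^ k * coeff ?p k)"
      unfolding c by (simp add: algebra_simps)
    also have "\<dots> > 0"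
      by (rule mult_pos_pos) (use IH in simp_all)
    finally have 1: "(-1) ^ Suc k * coeff (hahn_raise \<alpha> \<beta> N ?p) (Suc k) > 0" .
    have 2: "poly (hahn_raise \<alpha> \<beta> N ?p) 0 > 0" using IH N by (simp add: poly_hahn_raise)
    show ?case using 1 2 hahn_raise_coeff(1)[of ?p k \<alpha> \<beta> N] hahn_raise_orth[of \<alpha> \<beta> M k ?p] IH
      by (simp add: N)
  qed
  moreover from this have "degree (hahn_rodrigues \<alpha> \<beta> N k) \<ge> k"
    by (intro le_degree) auto
  ultimately show "degree (hahn_rodrigues \<alpha> \<beta> N k) = k"
    and "(-1) ^ k * coeff (hahn_rodrigues \<alpha> \<beta> N k) k > 0"
    and "poly (hahn_rodrigues \<alpha> \<beta> N k) 0 > 0"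
    and "orth_below \<alpha> \<beta> N k (hahn_rodrigues \<alpha> \<beta> N k)" by auto
qed

lemma hahn_family_exists: "\<exists>q. is_hahn_family \<alpha> \<beta> N q"
proof
  let ?r = "hahn_rodrigues \<alpha> \<beta> N"
  let ?c = "\<lambda>n. 1 / sqrt (hahn_inner \<alpha> \<beta> N (?r n) (?r n))"
  let ?q = "\<lambda>n. Polynomial.smult (?c n) (?r n)"
  have pos: "hahn_inner \<alpha> \<beta> N (?r n) (?r n) > 0" if "n \<le> N" for n
    using hahn_rodrigues_props(1,3)[OF that, of \<alpha> \<beta>] that by (intro hahn_inner_self_pos) auto
  have lt: "hahn_inner \<alpha> \<beta> N (?r n) (?r m) = 0" if "m < n" "n \<le> N" for m n
  proof -
    have "\<forall>i\<ge>n. coeff (?r m) i = 0"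
      using hahn_rodrigues_props(1)[of m N \<alpha> \<beta>] that by (auto intro!: coeff_eq_0)
    then show ?thesis using hahn_rodrigues_props(4)[OF that(2), of \<alpha> \<beta>] unfolding orth_below_def by blast
  qed
  have orth: "hahn_inner \<alpha> \<beta> N (?q n) (?q m) = (if m = n then 1 else 0)" if "m \<le> N" "n \<le> N" for m n
  proof -
    have "hahn_inner \<alpha> \<beta> N (?r n) (?r m) = 0" if "m \<noteq> n"
      using that lt[of m n] lt[of n m] \<open>m \<le> N\<close> \<open>n \<le> N\<close> by (cases "m < n") (auto simp: hahn_inner_commute)
    then show ?thesis using pos[OF that(2)] by (auto simp: hahn_inner_smult_left hahn_inner_smult_right real_div_sqrt field_simps)
  qed
  show "is_hahn_family \<alpha> \<beta> N ?q"
    unfolding is_hahn_family_def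
  proof (intro conjI allI impI)
    fix n assume n: "n \<le> N"
    show "degree (?q n) = n" using pos[OF n] hahn_rodrigues_props(1)[OF n] by simp
    show "poly (?q n) 0 > 0" using pos[OF n] hahn_rodrigues_props(3)[OF n] by simp
  next
    fix n m assume nm: "n \<le> N" "m \<le> N"
    show "(\<Sum>x=0..N. poly (?q n) (real x) * poly (?q m) (real x) * hahn_weight \<alpha> \<beta> N x) = (if m = n then 1 else 0)"
      using orth[OF nm(2,1)] unfolding hahn_inner_def .
  qed
qed

lemma hahn_poly_family: "is_hahn_family \<alpha> \<beta> N (hahn_poly \<alpha> \<beta> N)"
  unfolding hahn_poly_def by (rule someI_ex[OF hahn_family_exists])

lemma degree_hahn_poly: "k \<le> N \<Longrightarrow> degree (hahn_poly \<alpha> \<beta> N k) = k"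
  and hahn_poly_at_0: "k \<le> N \<Longrightarrow> poly (hahn_poly \<alpha> \<beta> N k) 0 > 0"
  and hahn_poly_orthonormal: "k \<le> N \<Longrightarrow> m \<le> N \<Longrightarrow>
    hahn_inner \<alpha> \<beta> N (hahn_poly \<alpha> \<beta> N k) (hahn_poly \<alpha> \<beta> N m) = (if m = k then 1 else 0)"
  using hahn_poly_family[of \<alpha> \<beta> N] unfolding is_hahn_family_def hahn_inner_def by blast+

lemma hahn_poly_lead_nonzero: "k \<le> N \<Longrightarrow> coeff (hahn_poly \<alpha> \<beta> N k) k \<noteq> 0"
  using degree_hahn_poly[of k N \<alpha> \<beta>] hahn_poly_at_0[of k N \<alpha> \<beta>] by (metis leading_coeff_0_iff less_irrefl poly_0)

lemma hahn_poly_orth_below: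
  assumes "k \<le> N"
  shows "orth_below \<alpha> \<beta> N k (hahn_poly \<alpha> \<beta> N k)"
proof -
  have "hahn_inner \<alpha> \<beta> N (hahn_poly \<alpha> \<beta> N k) r = 0" if "j \<le> k" "\<forall>i\<ge>j. coeff r i = 0" for j r
    using that
  proof (induction j arbitrary: r)
    case 0
    then have "r = 0" by (simp add: poly_eq_iff)
    then show ?case by (simp add: hahn_inner_def)
  next
    case (Suc j)
    let ?q = "hahn_poly \<alpha> \<beta> N j"
    let ?d = "r - Polynomial.smult (coeff r j / coeff ?q j) ?q"
    have j: "j \<le> N" "j < k" using Suc.prems assms by auto
    have low: "\<forall>i\<ge>j. coeff ?d i = 0"
    proof (intro allI impI)
      fix i assume "j \<le> i"
      then show "coeff ?d i = 0"
        using Suc.prems(2) hahn_poly_lead_nonzero[OF j(1), of \<alpha> \<beta>] degree_hahn_poly[OF j(1), of \<alpha> \<beta>]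
        by (cases "i = j") (auto simp: coeff_eq_0)
    qed
    have "hahn_inner \<alpha> \<beta> N (hahn_poly \<alpha> \<beta> N k) ?d = 0"
      by (rule Suc.IH[OF less_imp_le[OF j(2)] low])
    then show ?case using j assms
      by (simp add: hahn_inner_diff_right hahn_inner_smult_right hahn_poly_orthonormal)
  qed
  then show ?thesis by (auto simp: orth_below_def)
qed

text \<open>Only the multiple of the polynomial itself that has the same leading term contributes.\<close>

lemma hahn_poly_inner_lead:
  assumes "k \<le> N" and "degree r \<le> k"
  shows "hahn_inner \<alpha> \<beta> N (hahn_poly \<alpha> \<beta> N k) r = coeff r k / coeff (hahn_poly \<alpha> \<beta> N k) k"
proof -
  let ?q = "hahn_poly \<alpha> \<beta> N k"
  let ?d = "r - Polynomial.smult (coeff r k / coeff ?q k) ?q"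
  have "\<forall>i\<ge>k. coeff ?d i = 0"
  proof (intro allI impI)
    fix i assume "k \<le> i"
    then show "coeff ?d i = 0"
      using assms(2) hahn_poly_lead_nonzero[OF assms(1), of \<alpha> \<beta>] degree_hahn_poly[OF assms(1), of \<alpha> \<beta>]
      by (cases "i = k") (auto simp: coeff_eq_0)
  qed
  then have "hahn_inner \<alpha> \<beta> N ?q ?d = 0"
    using hahn_poly_orth_below[OF assms(1)] unfolding orth_below_def by blast
  then show ?thesis using assms(1)
    by (simp add: hahn_inner_diff_right hahn_inner_smult_right hahn_poly_orthonormal)
qed

text \<open>The normalisation fixes the sign at \<open>0\<close>; the ladder relations need the sign of the leading
coefficient, and Rodrigues' formula connects the two.\<close>

lemma hahn_poly_lead_sign:
  assumes "k \<le> N"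
  shows "(-1) ^ k * coeff (hahn_poly \<alpha> \<beta> N k) k > 0"
proof -
  let ?q = "hahn_poly \<alpha> \<beta> N k" and ?r = "hahn_rodrigues \<alpha> \<beta> N k"
  note r = hahn_rodrigues_props[OF assms, of \<alpha> \<beta>]
  have r0: "coeff ?r k \<noteq> 0" using r(2) by auto
  have eq: "?q = Polynomial.smult (coeff ?q k / coeff ?r k) ?r"
    using r r0 degree_hahn_poly[OF assms, of \<alpha> \<beta>] hahn_poly_orth_below[OF assms, of \<alpha> \<beta>]
    by (intro orth_below_unique[OF assms]) auto
  have "poly ?q 0 = (coeff ?q k / coeff ?r k) * poly ?r 0"
    by (subst eq) simp
  then have "coeff ?q k / coeff ?r k > 0"
    using hahn_poly_at_0[OF assms, of \<alpha> \<beta>] r(3) by (metis zero_less_mult_pos2)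
  then have "(coeff ?q k / coeff ?r k) * ((-1) ^ k * coeff ?r k) > 0" using r(2) by (rule mult_pos_pos)
  then show ?thesis using r0 by (simp add: mult.commute)
qed

text \<open>An operator with an adjoint of the opposite effect on degrees maps orthogonal polynomials to
orthogonal polynomials, because the adjoint keeps low degrees low. With \<open>p = T q = c q'\<close>, comparing
leading coefficients gives the sign of \<open>c\<close>, and \<open>c\<^sup>2 = \<langle>p, p\<rangle> = \<langle>q, T' T q\<rangle>\<close> is read off from the
leading coefficient of \<open>T' T q\<close>.\<close>

lemma hahn_ladder:
  fixes \<alpha>' \<beta>' N' k' \<alpha> \<beta> N k :: nat and T T' :: "real poly \<Rightarrow> real poly" and \<tau> \<tau>' :: real
  assumes k: "k \<le> N" "k' \<le> N'"
    and adj: "\<And>p q. hahn_inner \<alpha>' \<beta>' N' (T p) q = hahn_inner \<alpha> \<beta> N p (T' q)"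
    and T: "\<And>p. degree p \<le> k \<Longrightarrow> degree (T p) \<le> k' \<and> coeff (T p) k' = \<tau> * coeff p k"
    and T': "\<And>q. degree q \<le> k' \<Longrightarrow> degree (T' q) \<le> k \<and> coeff (T' q) k = \<tau>' * coeff q k'"
    and sign: "(-1) ^ k * (-1) ^ k' * \<tau> > 0"
  shows "T (hahn_poly \<alpha> \<beta> N k) = Polynomial.smult (sqrt (\<tau> * \<tau>')) (hahn_poly \<alpha>' \<beta>' N' k')"
proof -
  let ?q = "hahn_poly \<alpha> \<beta> N k" and ?q' = "hahn_poly \<alpha>' \<beta>' N' k'"
  let ?c = "coeff (T ?q) k' / coeff ?q' k'"
  have dq: "degree ?q \<le> k" "degree ?q' \<le> k'" using k degree_hahn_poly by auto
  note lead = hahn_poly_lead_nonzero[OF k(1), of \<alpha> \<beta>] hahn_poly_lead_nonzero[OF k(2), of \<alpha>' \<beta>']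
  have "orth_below \<alpha>' \<beta>' N' k' (T ?q)"
    unfolding orth_below_def
  proof (intro allI impI)
    fix r :: "real poly" assume r: "\<forall>i\<ge>k'. coeff r i = 0"
    then have "degree r \<le> k'" by (intro degree_le) auto
    from T'[OF this] r have "degree (T' r) \<le> k" "coeff (T' r) k = 0" by auto
    then show "hahn_inner \<alpha>' \<beta>' N' (T ?q) r = 0"
      unfolding adj by (simp add: hahn_poly_inner_lead[OF k(1)])
  qed
  then have eq: "T ?q = Polynomial.smult ?c ?q'"
    using T[OF dq(1)] dq lead hahn_poly_orth_below[OF k(2)] by (intro orth_below_unique[OF k(2)]) auto
  have "?c * ?c = hahn_inner \<alpha>' \<beta>' N' (T ?q) (T ?q)"
    by (subst (3 4) eq) (simp add: hahn_inner_smult_left hahn_inner_smult_right hahn_poly_orthonormal k)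
  also have "\<dots> = coeff (T' (T ?q)) k / coeff ?q k"
    unfolding adj using T' T[OF dq(1)] by (intro hahn_poly_inner_lead[OF k(1)]) auto
  also have "\<dots> = \<tau> * \<tau>'" using T[OF dq(1)] T'[of "T ?q"] lead by simp
  finally have sq: "?c ^ 2 = \<tau> * \<tau>'" by (simp add: power2_eq_square)
  have "((-1) ^ k * (-1) ^ k' * \<tau>) * ((-1) ^ k * coeff ?q k) * ((-1) ^ k' * coeff ?q' k') > 0"
    by (intro mult_pos_pos sign hahn_poly_lead_sign k)
  also have "((-1) ^ k * (-1) ^ k' * \<tau>) * ((-1) ^ k * coeff ?q k) * ((-1) ^ k' * coeff ?q' k')
    = \<tau> * coeff ?q k * coeff ?q' k'"
    by (simp add: algebra_simps power_mult_distrib[symmetric])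
  also have "\<dots> = ?c * (coeff ?q' k')\<^sup>2" using T[OF dq(1)] lead by (simp add: power2_eq_square)
  finally have "0 < ?c * (coeff ?q' k')\<^sup>2" .
  then have "?c > 0" by (rule zero_less_mult_pos2) (use lead in simp)
  then have c: "?c = sqrt (\<tau> * \<tau>')" using sq by (metis abs_of_pos real_sqrt_abs)
  show ?thesis using eq unfolding c .
qed

lemma hahn_raise_hahn_poly:
  assumes "k \<le> N"
  shows "hahn_raise \<alpha> \<beta> (Suc N) (hahn_poly (Suc \<alpha>) (Suc \<beta>) N k) =
    Polynomial.smult (sqrt (real (Suc k) * real (\<alpha> + \<beta> + 2 + k))) (hahn_poly \<alpha> \<beta> (Suc N) (Suc k))"
proof -
  have "hahn_raise \<alpha> \<beta> (Suc N) (hahn_poly (Suc \<alpha>) (Suc \<beta>) N k) =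
    Polynomial.smult (sqrt (- real (\<alpha> + \<beta> + 2 + k) * - real (Suc k))) (hahn_poly \<alpha> \<beta> (Suc N) (Suc k))"
  proof (rule hahn_ladder)
    show "hahn_inner \<alpha> \<beta> (Suc N) (hahn_raise \<alpha> \<beta> (Suc N) p) q =
     hahn_inner (Suc \<alpha>) (Suc \<beta>) N p (hahn_lower q)" for p q by (rule hahn_raise_adjoint)
  qed (use assms in \<open>auto simp: hahn_raise_coeff hahn_lower_coeff simp del: of_nat_Suc of_nat_add power_Suc simp: power_Suc mult.left_commute power_mult_distrib[symmetric]\<close>)
  then show ?thesis by (simp only: minus_mult_minus mult.commute)
qed

lemma hahn_lower_hahn_poly:
  assumes "k \<le> N"
  shows "hahn_lower (hahn_poly \<alpha> \<beta> (Suc N) (Suc k)) =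
    Polynomial.smult (sqrt (real (Suc k) * real (\<alpha> + \<beta> + 2 + k))) (hahn_poly (Suc \<alpha>) (Suc \<beta>) N k)"
proof -
  have "hahn_lower (hahn_poly \<alpha> \<beta> (Suc N) (Suc k)) =
    Polynomial.smult (sqrt (- real (Suc k) * - real (\<alpha> + \<beta> + 2 + k))) (hahn_poly (Suc \<alpha>) (Suc \<beta>) N k)"
  proof (rule hahn_ladder)
    show "hahn_inner (Suc \<alpha>) (Suc \<beta>) N (hahn_lower p) q =
      hahn_inner \<alpha> \<beta> (Suc N) p (hahn_raise \<alpha> \<beta> (Suc N) q)" for p q
      by (metis hahn_raise_adjoint hahn_inner_commute)
  qed (use assms in \<open>auto simp: hahn_raise_coeff hahn_lower_coeff simp del: of_nat_Suc of_nat_add power_Suc simp: power_Suc power_mult_distrib[symmetric]\<close>)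
  then show ?thesis by (simp only: minus_mult_minus)
qed

lemma hahn_lower_hahn_poly_0: "hahn_lower (hahn_poly \<alpha> \<beta> N 0) = 0"
  using degree_hahn_poly[of 0 N \<alpha> \<beta>] shift_difference_const[of "hahn_poly \<alpha> \<beta> N 0" 1]
  by (simp add: hahn_lower_def)

lemma hahn_shift_hahn_poly:
  assumes "k \<le> N"
  shows "hahn_shift (Suc \<alpha>) N (hahn_poly (Suc \<alpha>) \<beta> N k) =
    Polynomial.smult (sqrt (real (\<alpha> + 1 + k) * real (\<beta> + 1 + k))) (hahn_poly \<alpha> (Suc \<beta>) N k)"
proof (rule hahn_ladder)
  show "hahn_inner \<alpha> (Suc \<beta>) N (hahn_shift (Suc \<alpha>) N p) q = hahn_inner (Suc \<alpha>) \<beta> N p (hahn_unshift \<beta> q)"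
    for p q by (rule hahn_shift_adjoint)
qed (use assms in \<open>auto simp: hahn_shift_coeff hahn_unshift_coeff power_mult_distrib[symmetric]\<close>)

text \<open>Orthonormality says that a square matrix has a left inverse, hence also a right inverse.\<close>

lemma hahn_poly_complete:
  assumes "x \<le> N" and "y \<le> N"
  shows "(\<Sum>k=0..N. poly (hahn_poly \<alpha> \<beta> N k) (real x) * (poly (hahn_poly \<alpha> \<beta> N k) (real y) * hahn_weight \<alpha> \<beta> N y))
    = (if x = y then 1 else 0)"
proof -
  let ?A = "Matrix.mat (Suc N) (Suc N) (\<lambda>(k, x). poly (hahn_poly \<alpha> \<beta> N k) (real x) * hahn_weight \<alpha> \<beta> N x)"
  let ?B = "Matrix.mat (Suc N) (Suc N) (\<lambda>(x, k). poly (hahn_poly \<alpha> \<beta> N k) (real x))"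
  have "?A * ?B = 1\<^sub>m (Suc N)"
  proof (rule eq_matI)
    fix i j assume "i < dim_row (1\<^sub>m (Suc N))" "j < dim_col (1\<^sub>m (Suc N))"
    then have ij: "i \<le> N" "j \<le> N" by auto
    have "(?A * ?B) $$ (i, j) = hahn_inner \<alpha> \<beta> N (hahn_poly \<alpha> \<beta> N i) (hahn_poly \<alpha> \<beta> N j)"
      using ij by (simp add: scalar_prod_def hahn_inner_def atLeastLessThanSuc_atLeastAtMost ac_simps del: sum.op_ivl_Suc)
    then show "(?A * ?B) $$ (i, j) = 1\<^sub>m (Suc N) $$ (i, j)"
      using ij hahn_poly_orthonormal[OF ij, of \<alpha> \<beta>] by auto
  qed auto
  then have "?B * ?A = 1\<^sub>m (Suc N)" by (rule mat_mult_left_right_inverse[OF mat_carrier mat_carrier])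
  then have "(?B * ?A) $$ (x, y) = 1\<^sub>m (Suc N) $$ (x, y)" by simp
  then show ?thesis using assms
    by (simp add: scalar_prod_def atLeastLessThanSuc_atLeastAtMost ac_simps del: sum.op_ivl_Suc)
qed

section \<open>Counting non-intersecting walks\<close>

lemma det_mat_permutations:
  "Determinant.det (Matrix.mat n n f) =
    (\<Sum>p\<in>{p. p permutes {..<n}}. of_int (sign p) * (\<Prod>i<n. f (i, p i)))"
  for f :: "nat \<times> nat \<Rightarrow> real"
proof -
  have "f (i, p i) = Matrix.mat n n f $$ (i, p i)" if "p permutes {..<n}" "i < n" for p i
    using permutes_in_image[OF that(1), of i] that(2) by simp
  then show ?thesis
    by (auto simp: Determinant.det_def atLeast0LessThan intro!: sum.cong)
qed

text \<open>This replaces the rule for triangular matrices when no order of the rows and columns is at hand.\<close>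

lemma det_diagonal_only:
  fixes f :: "nat \<times> nat \<Rightarrow> real"
  assumes "\<And>p. p permutes {..<n} \<Longrightarrow> p \<noteq> id \<Longrightarrow> \<exists>i<n. f (i, p i) = 0"
  shows "Determinant.det (Matrix.mat n n f) = (\<Prod>i<n. f (i, i))"
proof -
  have "Determinant.det (Matrix.mat n n f) = (\<Sum>p\<in>{id}. of_int (sign p) * (\<Prod>i<n. f (i, p i)))"
    unfolding det_mat_permutations
  proof (rule sum.mono_neutral_right)
    show "\<forall>p\<in>{p. p permutes {..<n}} - {id}. of_int (sign p) * (\<Prod>i<n. f (i, p i)) = 0"
      using assms by (fastforce simp: prod_zero_iff)
  qed (auto simp: permutes_id finite_permutations)
  then show ?thesis by simp
qed

lemma det_row_expansion:
  fixes f :: "nat \<Rightarrow> 'b \<Rightarrow> nat \<Rightarrow> real"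
  assumes "finite S"
  shows "Determinant.det (Matrix.mat n n (\<lambda>(i, j). \<Sum>e\<in>S. f i e j)) =
    (\<Sum>\<epsilon>\<in>{..<n} \<rightarrow>\<^sub>E S. Determinant.det (Matrix.mat n n (\<lambda>(i, j). f i (\<epsilon> i) j)))"
proof -
  have "(\<Prod>i<n. \<Sum>e\<in>S. f i e (p i)) = (\<Sum>\<epsilon>\<in>{..<n} \<rightarrow>\<^sub>E S. \<Prod>i<n. f i (\<epsilon> i) (p i))" for p
    using assms by (intro prod_sum_PiE) auto
  then show ?thesis
    unfolding det_mat_permutations by (subst sum.swap) (simp add: sum_distrib_left)
qed

lemma strict_increasing_permutation_id:
  fixes p :: "nat \<Rightarrow> nat"
  assumes p: "p permutes {..<n}" and mono: "\<And>i j. i < j \<Longrightarrow> j < n \<Longrightarrow> p i < p j"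
  shows "p = id"
proof (rule permutes_natset_ge[OF p], rule ballI)
  fix i assume "i \<in> {..<n}"
  then have "i < n" by simp
  then show "i \<le> p i"
  proof (induction i)
    case (Suc i)
    then have "i \<le> p i" "p i < p (Suc i)" using mono by auto
    then show ?case by simp
  qed simp
qed

text \<open>The number of paths from \<open>p\<close> to \<open>(t, y)\<close> all of whose points lie in \<open>A\<close>. It is real valued since it
only occurs as a matrix entry. Before the time of \<open>p\<close> it is zero, so the indicator starts the
path at the right moment.\<close>

primrec paths_in :: "(nat \<times> int) set \<Rightarrow> nat \<times> int \<Rightarrow> nat \<Rightarrow> int \<Rightarrow> real" where
  "paths_in A p 0 y = (if (0, y) \<in> A then of_bool (p = (0, y)) else 0)"
| "paths_in A p (Suc t) y =
     (if (Suc t, y) \<in> A then of_bool (p = (Suc t, y)) + paths_in A p t (y - 1) + paths_in A p t (y + 1) else 0)"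

lemma paths_in_outside: "(t, y) \<notin> A \<Longrightarrow> paths_in A p t y = 0"
  by (cases t) auto

lemma paths_in_before: "t < fst p \<Longrightarrow> paths_in A p t y = 0"
  by (induction t arbitrary: y) auto

lemma paths_in_same_time: "paths_in A p (fst p) y = of_bool (p = (fst p, y) \<and> p \<in> A)"
proof (cases "fst p")
  case 0
  then show ?thesis by auto
next
  case (Suc t)
  then show ?thesis using paths_in_before[of t p A] by auto
qed

text \<open>The number of paths from \<open>p\<close> to \<open>(t, x)\<close> all of whose points except possibly the last one lie in \<open>A\<close>.\<close>

primrec first_hit :: "(nat \<times> int) set \<Rightarrow> nat \<times> int \<Rightarrow> nat \<Rightarrow> int \<Rightarrow> real" where
  "first_hit A p 0 x = of_bool (p = (0, x))"
| "first_hit A p (Suc t) x = of_bool (p = (Suc t, x)) + paths_in A p t (x - 1) + paths_in A p t (x + 1)"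

text \<open>A path in \<open>L\<close> either avoids \<open>S\<close> or has a first point \<open>q\<close> in \<open>S\<close>.\<close>

lemma paths_in_first_hit:
  assumes "finite S" and "S \<subseteq> L"
  shows "paths_in L p t y = paths_in (L - S) p t y +
    (\<Sum>q\<in>S. first_hit (L - S) p (fst q) (snd q) * paths_in L q t y)"
proof (induction t arbitrary: y)
  case 0
  have "(\<Sum>q\<in>S. first_hit (L - S) p (fst q) (snd q) * of_bool (q = (0, y))) =
      (\<Sum>q\<in>S. if q = (0, y) then first_hit (L - S) p 0 y else 0)"
    by (intro sum.cong) auto
  then show ?case using assms by (auto simp: sum.delta)
next
  case (Suc t)
  let ?f = "\<lambda>q. first_hit (L - S) p (fst q) (snd q)"
  show ?case
  proof (cases "(Suc t, y) \<in> L")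
    case True
    have "(\<Sum>q\<in>S. ?f q * of_bool (q = (Suc t, y))) =
        (\<Sum>q\<in>S. if q = (Suc t, y) then first_hit (L - S) p (Suc t) y else 0)"
      by (intro sum.cong) auto
    also have "\<dots> = (if (Suc t, y) \<in> S then first_hit (L - S) p (Suc t) y else 0)"
      using assms by (simp add: sum.delta)
    finally have d: "(\<Sum>q\<in>S. ?f q * of_bool (q = (Suc t, y))) = \<dots>" .
    have "(\<Sum>q\<in>S. ?f q * paths_in L q (Suc t) y) = (\<Sum>q\<in>S. ?f q * of_bool (q = (Suc t, y)))
      + (\<Sum>q\<in>S. ?f q * paths_in L q t (y - 1)) + (\<Sum>q\<in>S. ?f q * paths_in L q t (y + 1))"
      using True by (simp add: distrib_left sum.distrib)
    then show ?thesis
      unfolding d using True Suc.IH[of "y - 1"] Suc.IH[of "y + 1"] by simp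
  qed simp
qed

text \<open>The walk families of the theorem, with arbitrary duration and end points, confined to a set.\<close>

definition walks_to :: "(nat \<times> int) set \<Rightarrow> nat \<Rightarrow> nat \<Rightarrow> (nat \<Rightarrow> int) \<Rightarrow> (nat \<Rightarrow> nat \<Rightarrow> int) set" where
  "walks_to A a T y =
     {w \<in> {..<a} \<rightarrow>\<^sub>E ({..T} \<rightarrow>\<^sub>E UNIV).
        (\<forall>i<a. w i 0 = 2 * int i) \<and>
        (\<forall>i<a. w i T = y i) \<and>
        (\<forall>i<a. \<forall>t<T. w i (Suc t) = w i t + 1 \<or> w i (Suc t) = w i t - 1) \<and>
        (\<forall>i<a. \<forall>j<a. \<forall>t\<le>T. i \<noteq> j \<longrightarrow> w i t \<noteq> w j t) \<and>
        (\<forall>i<a. \<forall>t\<le>T. (t, w i t) \<in> A)}"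

lemma unit_steps_bounds:
  fixes f :: "nat \<Rightarrow> int"
  assumes "\<And>t. t < T \<Longrightarrow> f (Suc t) = f t + 1 \<or> f (Suc t) = f t - 1" and "s \<le> t" and "t \<le> T"
  shows "f t - f s \<le> int (t - s) \<and> f s - f t \<le> int (t - s) \<and> even (f t - f s - int (t - s))"
  using assms(2,3)
proof (induction t rule: dec_induct)
  case (step t)
  then have "f (Suc t) = f t + 1 \<or> f (Suc t) = f t - 1" using assms(1) by simp
  then show ?case using step by (auto simp: Suc_diff_le)
qed simp

lemma walks_toD:
  assumes "w \<in> walks_to A a T y" and "i < a"
  shows "w i 0 = 2 * int i" and "w i T = y i"
    and "t < T \<Longrightarrow> w i (Suc t) = w i t + 1 \<or> w i (Suc t) = w i t - 1"
    and "j < a \<Longrightarrow> t \<le> T \<Longrightarrow> i \<noteq> j \<Longrightarrow> w i t \<noteq> w j t"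
    and "t \<le> T \<Longrightarrow> (t, w i t) \<in> A"
  using assms by (auto simp: walks_to_def)

text \<open>Cutting off the last step leaves a family of walks ending at \<open>y + \<epsilon>\<close> for a vector \<open>\<epsilon>\<close> of signs.\<close>

lemma walks_to_last_step:
  assumes y: "\<And>i j. i < a \<Longrightarrow> j < a \<Longrightarrow> i \<noteq> j \<Longrightarrow> y i \<noteq> y j"
    and A: "\<And>i. i < a \<Longrightarrow> (Suc T, y i) \<in> A"
  shows "bij_betw (\<lambda>w. \<lambda>i\<in>{..<a}. restrict (w i) {..T}) (walks_to A a (Suc T) y)
    (\<Union>\<epsilon>\<in>{..<a} \<rightarrow>\<^sub>E {1, -1}. walks_to A a T (\<lambda>i. y i + \<epsilon> i))"
proof (rule bij_betw_byWitness[where f' = "\<lambda>v. \<lambda>i\<in>{..<a}. \<lambda>t\<in>{..Suc T}. if t \<le> T then v i t else y i"])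
  let ?R = "\<lambda>w. \<lambda>i\<in>{..<a}. restrict (w i) {..T}"
  let ?E = "\<lambda>v. \<lambda>i\<in>{..<a}. \<lambda>t\<in>{..Suc T}. if t \<le> T then v i t else y i"
  let ?U = "\<Union>\<epsilon>\<in>{..<a} \<rightarrow>\<^sub>E {1, -1}. walks_to A a T (\<lambda>i. y i + \<epsilon> i)"
  show "\<forall>w\<in>walks_to A a (Suc T) y. ?E (?R w) = w"
  proof
    fix w assume w: "w \<in> walks_to A a (Suc T) y"
    have "?E (?R w) i = w i" for i
    proof (cases "i < a")
      case True
      then have "w i \<in> {..Suc T} \<rightarrow>\<^sub>E UNIV" "w i (Suc T) = y i" using w by (auto simp: walks_to_def)
      then show ?thesis using True by (auto simp: fun_eq_iff PiE_iff extensional_def le_Suc_eq)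
    next
      case False
      then show ?thesis using w by (auto simp: walks_to_def PiE_iff extensional_def)
    qed
    then show "?E (?R w) = w" by (rule ext)
  qed
  show "\<forall>v\<in>?U. ?R (?E v) = v"
  proof
    fix v assume "v \<in> ?U"
    then have v: "v \<in> {..<a} \<rightarrow>\<^sub>E ({..T} \<rightarrow>\<^sub>E UNIV)" by (auto simp: walks_to_def)
    have "?R (?E v) i = v i" for i
    proof (cases "i < a")
      case True
      then have "v i \<in> {..T} \<rightarrow>\<^sub>E UNIV" using v by auto
      then show ?thesis using True by (auto simp: fun_eq_iff PiE_iff extensional_def)
    next
      case False
      then show ?thesis using v by (auto simp: PiE_iff extensional_def)
    qed
    then show "?R (?E v) = v" by (rule ext)
  qed
  show "?R ` walks_to A a (Suc T) y \<subseteq> ?U"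
  proof (rule image_subsetI)
    fix w assume w: "w \<in> walks_to A a (Suc T) y"
    \<comment> \<open>The last step taken backwards.\<close>
    let ?\<epsilon> = "\<lambda>i\<in>{..<a}. w i T - y i"
    have "w i (Suc T) = w i T + 1 \<or> w i (Suc T) = w i T - 1" "w i (Suc T) = y i" if "i < a" for i
      using walks_toD(2)[OF w that] walks_toD(3)[OF w that lessI] by simp_all
    then have "w i T - y i = 1 \<or> w i T - y i = -1" if "i < a" for i using that by fastforce
    then have "?\<epsilon> \<in> {..<a} \<rightarrow>\<^sub>E {1, -1}" by auto
    moreover have "?R w \<in> walks_to A a T (\<lambda>i. y i + ?\<epsilon> i)"
      using w by (auto simp: walks_to_def)
    ultimately show "?R w \<in> ?U" by blast
  qed
  show "?E ` ?U \<subseteq> walks_to A a (Suc T) y"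
  proof (rule image_subsetI)
    fix v assume "v \<in> ?U"
    then obtain \<epsilon> where \<epsilon>: "\<epsilon> \<in> {..<a} \<rightarrow>\<^sub>E {1, -1}" and v: "v \<in> walks_to A a T (\<lambda>i. y i + \<epsilon> i)" by blast
    have e: "\<epsilon> i = 1 \<or> \<epsilon> i = -1" if "i < a" for i using \<epsilon> that by auto
    have vT: "v i T = y i + \<epsilon> i" if "i < a" for i using v that by (auto simp: walks_to_def)
    have step: "?E v i (Suc t) = ?E v i t + 1 \<or> ?E v i (Suc t) = ?E v i t - 1" if "i < a" "t < Suc T" for i t
    proof (cases "t = T")
      case True
      then show ?thesis using e[OF that(1)] vT[OF that(1)] that by auto
    next
      case False
      then show ?thesis using v that by (auto simp: walks_to_def)
    qed
    have vv: "v i t \<noteq> v j t" if "i < a" "j < a" "i \<noteq> j" "t \<le> T" for i j t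
      using walks_toD[OF v] that by blast
    have vA: "(t, v i t) \<in> A" if "i < a" "t \<le> T" for i t
      using walks_toD[OF v] that by blast
    have v0: "v i 0 = 2 * int i" if "i < a" for i
      using walks_toD[OF v] that by blast
    have "?E v i t \<noteq> ?E v j t" if "i < a" "j < a" "t \<le> Suc T" "i \<noteq> j" for i j t
      using that y[of i j] vv[of i j t] by auto
    moreover have "(t, ?E v i t) \<in> A" if "i < a" "t \<le> Suc T" for i t
      using that A[of i] vA[of i t] by (auto simp: le_Suc_eq)
    ultimately show "?E v \<in> walks_to A a (Suc T) y"
      using step v0 unfolding walks_to_def by (auto simp del: restrict_apply) (auto split: if_splits)
  qed
qed

lemma walks_to_coinciding_ends:
  assumes "i < a" and "j < a" and "i \<noteq> j" and "y i = y j"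
  shows "walks_to A a T y = {}"
    and "Determinant.det (Matrix.mat a a (\<lambda>(i, j). paths_in A (0, 2 * int j) T (y i))) = 0"
proof -
  have "w i T = y i" "w j T = y j" "w i T \<noteq> w j T" if "w \<in> walks_to A a T y" for w
    using walks_toD(2)[OF that] walks_toD(4)[OF that assms(1,2) order.refl assms(3)] assms(1,2) by simp_all
  then show "walks_to A a T y = {}" using assms(4) by fastforce
  show "Determinant.det (Matrix.mat a a (\<lambda>(i, j). paths_in A (0, 2 * int j) T (y i))) = 0"
    by (rule det_identical_rows[OF mat_carrier assms(3) assms(1) assms(2)])
      (use assms in \<open>auto intro!: eq_vecI\<close>)
qed

text \<open>Both sides satisfy the same recursion in \<open>T\<close>. The last step of each walk is expanded by cutting off
on the left, and by multilinearity of the determinant in the rows on the right. The end points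
\<open>y + \<epsilon>\<close> of the shortened walks are in general only weakly increasing, thanks to the common
parity; if two of them coincide, then there are no non-intersecting walks and the determinant has
two equal rows. Weakly increasing end points are therefore the right generality for the induction.\<close>

theorem karlin_mcgregor:
  assumes "\<And>i j. i < j \<Longrightarrow> j < a \<Longrightarrow> y i \<le> y j"
    and "\<And>i j. i < a \<Longrightarrow> j < a \<Longrightarrow> even (y j - y i)"
  shows "finite (walks_to A a T y) \<and> real (card (walks_to A a T y)) =
    Determinant.det (Matrix.mat a a (\<lambda>(i, j). paths_in A (0, 2 * int j) T (y i)))"
  using assms
proof (induction T arbitrary: y)
  case (0 y)
  let ?f = "\<lambda>(i, j). paths_in A (0, 2 * int j) 0 (y i)"
  show ?case
  proof (cases "\<exists>i<a. \<exists>j<a. i \<noteq> j \<and> y i = y j")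
    case True
    then show ?thesis using walks_to_coinciding_ends[of _ a _ y A 0] by fastforce
  next
    case False
    have less: "y i < y j" if "i < j" "j < a" for i j
      using 0(1)[OF that] False that by (metis less_le less_trans)
    have "Determinant.det (Matrix.mat a a ?f) = (\<Prod>i<a. ?f (i, i))"
    proof (rule det_diagonal_only)
      fix p assume p: "p permutes {..<a}" "p \<noteq> id"
      show "\<exists>i<a. ?f (i, p i) = 0"
      proof (rule ccontr)
        assume "\<not> (\<exists>i<a. ?f (i, p i) = 0)"
        then have eq: "y i = 2 * int (p i)" if "i < a" for i
          using that by (auto split: if_splits)
        have "p i < p j" if "i < j" "j < a" for i j
          using less[OF that] eq[of i] eq[of j] that by simp
        then have "p = id" by (rule strict_increasing_permutation_id[OF p(1)])
        with p(2) show False by simp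
      qed
    qed
    moreover have "finite (walks_to A a 0 y) \<and> real (card (walks_to A a 0 y)) = (\<Prod>i<a. ?f (i, i))"
    proof (cases "\<forall>i<a. y i = 2 * int i \<and> (0, y i) \<in> A")
      case True
      let ?w = "\<lambda>i\<in>{..<a}. \<lambda>t\<in>{..0::nat}. 2 * int i"
      have "w = ?w" if "w \<in> walks_to A a 0 y" for w
      proof
        fix i
        have "w \<in> {..<a} \<rightarrow>\<^sub>E ({..0} \<rightarrow>\<^sub>E UNIV)" "\<forall>i<a. w i 0 = 2 * int i"
          using that by (simp_all add: walks_to_def)
        then show "w i = ?w i"
          by (cases "i < a") (auto simp: fun_eq_iff PiE_iff extensional_def)
      qed
      moreover have "?w \<in> walks_to A a 0 y" using True by (auto simp: walks_to_def)
      ultimately have "walks_to A a 0 y = {?w}" by blast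
      moreover have "(\<Prod>i<a. ?f (i, i)) = 1" using True by (intro prod.neutral) auto
      ultimately show ?thesis by simp
    next
      case F: False
      then obtain i where i: "i < a" "\<not> (y i = 2 * int i \<and> (0, y i) \<in> A)" by blast
      have "w i 0 = 2 * int i" "w i 0 = y i" "(0, w i 0) \<in> A" if "w \<in> walks_to A a 0 y" for w
        using walks_toD(1,2)[OF that i(1)] walks_toD(5)[OF that i(1), of 0] by simp_all
      then have "walks_to A a 0 y = {}" using i(2) by fastforce
      moreover have "(\<Prod>i<a. ?f (i, i)) = 0"
        using i by (intro prod_zero bexI[of _ i]) auto
      ultimately show ?thesis by simp
    qed
    ultimately show ?thesis by simp
  qed
next
  case (Suc T y)
  let ?f = "\<lambda>(i, j). paths_in A (0, 2 * int j) (Suc T) (y i)"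
  let ?E = "{..<a} \<rightarrow>\<^sub>E {1, -1::int}"
  let ?g = "\<lambda>\<epsilon> (i, j). paths_in A (0, 2 * int j) T (y i + \<epsilon> i)"
  show ?case
  proof (cases "\<exists>i<a. \<exists>j<a. i \<noteq> j \<and> y i = y j")
    case True
    then show ?thesis using walks_to_coinciding_ends[of _ a _ y A "Suc T"] by fastforce
  next
    case distinct: False
    have less: "y i < y j" if "i < j" "j < a" for i j
      using Suc.prems(1)[OF that] distinct that by (metis less_le less_trans)
    show ?thesis
    proof (cases "\<forall>i<a. (Suc T, y i) \<in> A")
      case False
      then obtain i where i: "i < a" "(Suc T, y i) \<notin> A" by blast
      have "w i (Suc T) = y i" "(Suc T, w i (Suc T)) \<in> A" if "w \<in> walks_to A a (Suc T) y" for w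
        using walks_toD(2)[OF that i(1)] walks_toD(5)[OF that i(1) order.refl] by simp_all
      then have "walks_to A a (Suc T) y = {}" using i(2) by fastforce
      moreover have "Determinant.det (Matrix.mat a a ?f) = 0"
        unfolding det_mat_permutations using i by (intro sum.neutral ballI) (auto intro!: prod_zero)
      ultimately show ?thesis by simp
    next
      case True
      have IH: "finite (walks_to A a T (\<lambda>i. y i + \<epsilon> i)) \<and> real (card (walks_to A a T (\<lambda>i. y i + \<epsilon> i))) =
          Determinant.det (Matrix.mat a a (?g \<epsilon>))" if \<epsilon>: "\<epsilon> \<in> ?E" for \<epsilon>
      proof (rule Suc.IH)
        have e: "\<epsilon> i = 1 \<or> \<epsilon> i = -1" if "i < a" for i using \<epsilon> that by auto
        show "y i + \<epsilon> i \<le> y j + \<epsilon> j" if "i < j" "j < a" for i j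
        proof -
          from that have "i < a" by simp
          \<comment> \<open>Different heights of equal parity are at least two apart, so moving each by one keeps them weakly ordered.\<close>
          have "even (y j - y i)" using that by (intro Suc.prems(2)) auto
          then have "y j - y i \<ge> 2" using less[OF that] by presburger
          then show ?thesis using e[OF that(2)] e[OF \<open>i < a\<close>] by auto
        qed
        show "even (y j + \<epsilon> j - (y i + \<epsilon> i))" if "i < a" "j < a" for i j
          using Suc.prems(2)[OF that] e[OF that(1)] e[OF that(2)] by presburger
      qed
      let ?B = "\<lambda>\<epsilon>. walks_to A a T (\<lambda>i. y i + \<epsilon> i)"
      have fin: "finite ?E" by (intro finite_PiE) auto
      have bij: "bij_betw (\<lambda>w. \<lambda>i\<in>{..<a}. restrict (w i) {..T}) (walks_to A a (Suc T) y) (\<Union>\<epsilon>\<in>?E. ?B \<epsilon>)"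
        using distinct True by (intro walks_to_last_step) auto
      have disj: "?B \<epsilon> \<inter> ?B \<delta> = {}" if "\<epsilon> \<in> ?E" "\<delta> \<in> ?E" "\<epsilon> \<noteq> \<delta>" for \<epsilon> \<delta>
      proof -
        have "\<exists>i<a. \<epsilon> i \<noteq> \<delta> i" by (rule ccontr) (use PiE_ext[OF that(1,2)] that(3) in auto)
        then obtain i where i: "i < a" "\<epsilon> i \<noteq> \<delta> i" by blast
        have False if w: "w \<in> ?B \<epsilon>" "w \<in> ?B \<delta>" for w
          using walks_toD(2)[OF w(1) i(1)] walks_toD(2)[OF w(2) i(1)] i(2) by simp
        then show ?thesis by blast
      qed
      have "finite (\<Union>\<epsilon>\<in>?E. ?B \<epsilon>)" using fin IH by blast
      then have 1: "finite (walks_to A a (Suc T) y)" using bij bij_betw_finite by blast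
      have "real (card (walks_to A a (Suc T) y)) = real (card (\<Union>\<epsilon>\<in>?E. ?B \<epsilon>))"
        using bij_betw_same_card[OF bij] by simp
      also have "card (\<Union>\<epsilon>\<in>?E. ?B \<epsilon>) = (\<Sum>\<epsilon>\<in>?E. card (?B \<epsilon>))"
        using fin IH disj by (intro card_UN_disjoint) blast+
      also have "real \<dots> = (\<Sum>\<epsilon>\<in>?E. Determinant.det (Matrix.mat a a (?g \<epsilon>)))"
        using IH by simp
      also have "\<dots> = Determinant.det (Matrix.mat a a (\<lambda>(i, j). \<Sum>e\<in>{1, -1::int}. paths_in A (0, 2 * int j) T (y i + e)))"
        by (subst det_row_expansion) auto
      also have "Matrix.mat a a (\<lambda>(i, j). \<Sum>e\<in>{1, -1::int}. paths_in A (0, 2 * int j) T (y i + e)) = Matrix.mat a a ?f"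
        using True by (intro eq_matI) (auto simp: add.commute)
      finally show ?thesis using 1 by blast
    qed
  qed
qed

section \<open>Determinants\<close>

text \<open>The matrix with blocks \<open>G\<close>, \<open>U X\<close>, \<open>Y V\<close>, \<open>Y X\<close> has two factorisations into block triangular
matrices: clearing the lower left block with \<open>F\<close> gives the left-hand side, and splitting off
\<open>Y\<close> and \<open>X\<close> gives the right-hand side. In the application \<open>G\<close> holds the path counts between the
points of \<open>S\<close>, and \<open>Y V = F G\<close> is the decomposition at the first visit to \<open>S\<close>; having the matrix
of all paths in the factorised form \<open>Y X\<close> makes it unnecessary to invert it.\<close>

lemma det_bordered:
  fixes G U V X Y F :: "real mat"
  assumes G: "G \<in> carrier_mat n n" and U: "U \<in> carrier_mat n a" and V: "V \<in> carrier_mat a n"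
    and X: "X \<in> carrier_mat a a" and Y: "Y \<in> carrier_mat a a" and F: "F \<in> carrier_mat a n"
    and YV: "Y * V = F * G"
  shows "Determinant.det G * Determinant.det (Y * X - F * (U * X)) =
    Determinant.det (G - U * V) * Determinant.det Y * Determinant.det X"
proof -
  let ?O = "0\<^sub>m n a" and ?Q = "0\<^sub>m a n"
  let ?Z = "four_block_mat G (U * X) (Y * V) (Y * X)"
  let ?M = "Y * X - F * (U * X)"
  have UX: "U * X \<in> carrier_mat n a" and YX: "Y * X \<in> carrier_mat a a"
    and FUX: "F * (U * X) \<in> carrier_mat a a" and UV: "U * V \<in> carrier_mat n n" using assms by auto
  have M: "?M \<in> carrier_mat a a" using FUX by (intro minus_carrier_mat)
  have K: "G - U * V \<in> carrier_mat n n" using UV by (intro minus_carrier_mat)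
  have cancel: "A + (B - A) = B" "B - A + A = B"
    if "A \<in> carrier_mat k l" "B \<in> carrier_mat k l" for A B :: "real mat" and k l
    using that by (auto intro!: eq_matI)
  have e: "F * (U * X) + ?M = Y * X" "G - U * V + U * V = G"
    using cancel[OF FUX YX] cancel[OF UV G] by auto
  have "1\<^sub>m n * (U * X) + ?O * ?M = U * X"
    by (simp only: left_mult_one_mat[OF UX] left_mult_zero_mat[OF M] right_add_zero_mat[OF UX])
  moreover have "1\<^sub>m n * G + ?O * ?Q = G" "F * G + 1\<^sub>m a * ?Q = Y * V"
    "F * (U * X) + 1\<^sub>m a * ?M = Y * X"
    using G UX F M YV e(1) by simp_all
  ultimately have "four_block_mat (1\<^sub>m n) ?O F (1\<^sub>m a) * four_block_mat G (U * X) ?Q ?M = ?Z"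
    by (subst mult_four_block_mat[OF one_carrier_mat zero_carrier_mat F one_carrier_mat G UX zero_carrier_mat M]) simp
  then have "Determinant.det ?Z = Determinant.det (four_block_mat (1\<^sub>m n) ?O F (1\<^sub>m a)) *
      Determinant.det (four_block_mat G (U * X) ?Q ?M)"
    using G UX M F by (subst det_mult[symmetric, where n = "n + a"]) auto
  also have "Determinant.det (four_block_mat (1\<^sub>m n) ?O F (1\<^sub>m a)) = 1"
    using F by (subst det_four_block_mat_upper_right_zero[where n=n and m=a]) auto
  also have "Determinant.det (four_block_mat G (U * X) ?Q ?M) = Determinant.det G * Determinant.det ?M"
    using G UX M by (subst det_four_block_mat_lower_left_zero[where n=n and m=a]) auto
  finally have 1: "Determinant.det ?Z = Determinant.det G * Determinant.det ?M" by simp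
  have YV_carrier: "Y * V \<in> carrier_mat a n" using Y V by simp
  have "(G - U * V) * 1\<^sub>m n + U * V = G" "(G - U * V) * ?O + U * X = U * X"
    "?Q * 1\<^sub>m n + Y * V = Y * V" "?Q * ?O + Y * X = Y * X"
    by (simp_all only: right_mult_one_mat[OF K] right_mult_zero_mat[OF K] left_mult_zero_mat[OF one_carrier_mat]
      left_mult_zero_mat[OF zero_carrier_mat] left_add_zero_mat[OF UX] left_add_zero_mat[OF YX]
      left_add_zero_mat[OF YV_carrier] e(2))
  then have "four_block_mat (G - U * V) U ?Q Y * four_block_mat (1\<^sub>m n) ?O V X = ?Z"
    by (subst mult_four_block_mat[OF K U zero_carrier_mat Y one_carrier_mat zero_carrier_mat V X]) simp
  then have "Determinant.det ?Z = Determinant.det (four_block_mat (G - U * V) U ?Q Y) *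
      Determinant.det (four_block_mat (1\<^sub>m n) ?O V X)"
    using K U V X Y by (subst det_mult[symmetric, where n = "n + a"]) auto
  also have "Determinant.det (four_block_mat (G - U * V) U ?Q Y) = Determinant.det (G - U * V) * Determinant.det Y"
    using K U Y by (subst det_four_block_mat_lower_left_zero[where n=n and m=a]) auto
  also have "Determinant.det (four_block_mat (1\<^sub>m n) ?O V X) = Determinant.det X"
    using V X by (subst det_four_block_mat_upper_right_zero[where n=n and m=a]) auto
  finally show ?thesis using 1 by simp
qed

lemma det_conjugate:
  fixes f :: "nat \<Rightarrow> nat \<Rightarrow> real"
  assumes "\<And>i. i < n \<Longrightarrow> g i \<noteq> 0"
  shows "Determinant.det (Matrix.mat n n (\<lambda>(i, j). f i j * g j / g i)) = Determinant.det (Matrix.mat n n (\<lambda>(i, j). f i j))"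
proof -
  have "(\<Prod>i<n. f i (p i) * g (p i) / g i) = (\<Prod>i<n. f i (p i))" if p: "p permutes {..<n}" for p
  proof -
    have "(\<Prod>i<n. g (p i)) = (\<Prod>i<n. g i)"
      using prod.permute[OF p, of g] by (simp add: comp_def)
    moreover have "(\<Prod>i<n. g i) \<noteq> 0" using assms by simp
    ultimately show ?thesis by (simp add: prod.distrib prod_dividef)
  qed
  then show ?thesis unfolding det_mat_permutations by (intro sum.cong) auto
qed

text \<open>Along a nonzero entry time does not decrease, and it stays the same only on the diagonal. A
permutation preserves the sum of all times, so it has to be the identity.\<close>

lemma det_path_counts:
  assumes "distinct ps" and "set ps \<subseteq> L"
  shows "Determinant.det (Matrix.mat (length ps) (length ps)
    (\<lambda>(i, j). paths_in L (ps ! i) (fst (ps ! j)) (snd (ps ! j)))) = 1"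
proof -
  let ?n = "length ps"
  let ?f = "\<lambda>(i, j). paths_in L (ps ! i) (fst (ps ! j)) (snd (ps ! j))"
  have "Determinant.det (Matrix.mat ?n ?n ?f) = (\<Prod>i<?n. ?f (i, i))"
  proof (rule det_diagonal_only)
    fix p assume p: "p permutes {..<?n}" "p \<noteq> id"
    show "\<exists>i<?n. ?f (i, p i) = 0"
    proof (rule ccontr)
      assume "\<not> (\<exists>i<?n. ?f (i, p i) = 0)"
      then have nz: "?f (i, p i) \<noteq> 0" if "i < ?n" for i using that by blast
      let ?t = "\<lambda>i. fst (ps ! i)"
      have le: "?t i \<le> ?t (p i)" if "i < ?n" for i
        using nz[OF that] paths_in_before[of "?t (p i)" "ps ! i" L] by (cases "?t (p i) < ?t i") auto
      have "(\<Sum>i<?n. ?t (p i)) = (\<Sum>i<?n. ?t i)"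
        using sum.permute[OF p(1), of ?t] by (simp add: comp_def)
      then have eq: "?t i = ?t (p i)" if "i < ?n" for i
        using sum_mono_inv[of ?t "{..<?n}" "\<lambda>i. ?t (p i)" i] le that by auto
      have "p i = i" if i: "i < ?n" for i
      proof -
        have "ps ! i = ps ! p i"
          using nz[OF i] paths_in_same_time[of L "ps ! i" "snd (ps ! p i)"] eq[OF i]
          by (auto simp: prod_eq_iff split: if_splits)
        moreover have "p i < ?n" using permutes_in_image[OF p(1), of i] i by simp
        ultimately show ?thesis using assms(1) i by (simp add: nth_eq_iff_index_eq)
      qed
      moreover have "p i = i" if "\<not> i < ?n" for i using p(1) that by (simp add: permutes_not_in)
      ultimately have "p = id" by (metis eq_id_iff)
      with p(2) show False by simp
    qed
  qed
  also have "\<dots> = 1"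
    using assms(2) nth_mem by (intro prod.neutral) (fastforce simp: paths_in_same_time)
  finally show ?thesis .
qed

section \<open>The transition between neighbouring lines\<close>

text \<open>The left-hand side is one step of the walk from a line with \<open>r < b\<close>, up to signs \<open>(-1)\<^sup>y\<close>, applied to
\<open>p\<close> times the weight. The next lemma is the counterpart for the lines between \<open>b\<close> and \<open>c\<close>.\<close>

lemma hahn_raise_transition:
  assumes "y \<le> Suc M"
  shows "(if y \<le> M then hahn_weight (Suc \<alpha>) (Suc \<beta>) M y * poly p (real y) else 0)
       - (if 1 \<le> y then hahn_weight (Suc \<alpha>) (Suc \<beta>) M (y - 1) * poly p (real (y - 1)) else 0)
       = hahn_weight \<alpha> \<beta> (Suc M) y * poly (hahn_raise \<alpha> \<beta> (Suc M) p) (real y)"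
proof -
  let ?w = "hahn_weight \<alpha> \<beta> (Suc M)" and ?v = "hahn_weight (Suc \<alpha>) (Suc \<beta>) M"
  have 1: "(if y \<le> M then ?v y * poly p (real y) else 0)
      = ?w y * ((real \<beta> + 1 + real y) * (real (Suc M) - real y)) * poly p (real y)"
  proof (cases "y \<le> M")
    case True
    then show ?thesis by (simp only: hahn_weight_raise(1) if_True)
  next
    case False
    with assms have "y = Suc M" by simp
    then show ?thesis by simp
  qed
  have 2: "(if 1 \<le> y then ?v (y - 1) * poly p (real (y - 1)) else 0)
      = ?w y * (real y * (real (Suc M + \<alpha>) + 1 - real y)) * poly p (real y - 1)"
  proof (cases y)
    case (Suc z)
    then have "z \<le> M" using assms by simp
    show ?thesis unfolding Suc hahn_weight_raise(2)[OF \<open>z \<le> M\<close>] by simp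
  qed simp
  show ?thesis unfolding 1 2 poly_hahn_raise by (simp add: algebra_simps)
qed

lemma hahn_shift_transition:
  assumes "y \<le> N"
  shows "fact (N + Suc \<alpha> - y) / fact (N - y) * poly p (real y)
       - (if Suc y \<le> N then fact (N + Suc \<alpha> - Suc y) / fact (N - Suc y) * poly p (real (Suc y)) else 0)
       = fact (N + \<alpha> - y) / fact (N - y) * poly (hahn_shift (Suc \<alpha>) N p) (real y)"
proof -
  obtain k where N: "N = y + k" using assms le_Suc_ex by blast
  show ?thesis
  proof (cases k)
    case 0
    then show ?thesis by (simp add: N poly_hahn_shift algebra_simps)
  next
    case (Suc j)
    have "(fact (Suc (\<alpha> + Suc j)) :: real) = (1 + real \<alpha> + real (Suc j)) * fact (\<alpha> + Suc j)" 
      "(fact (Suc j) :: real) = real (Suc j) * fact j" by simp_all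
    then show ?thesis
      by (simp add: N Suc poly_hahn_shift del: fact_Suc of_nat_Suc) (simp add: divide_simps, simp add: algebra_simps)
  qed
qed

locale hexagon =
  fixes a b c :: nat
  assumes a_pos: "a > 0" and b_pos: "b > 0" and b_le_c: "b \<le> c"
begin

abbreviation "\<gamma> \<equiv> gamma_line a b c"
abbreviation "\<Lambda> \<equiv> Lambda_set a b c"
abbreviation "blue \<equiv> blue_count a b c"

text \<open>Points of the hexagon are addressed by their line and their position on it, counted from below.\<close>

definition pt :: "nat \<Rightarrow> nat \<Rightarrow> nat \<times> int" where
  "pt r x = (r, alpha_line b r + 2 * int x)"

definition hahn_on :: "int \<Rightarrow> nat \<Rightarrow> nat \<Rightarrow> real" where
  "hahn_on n r x = hahn (a_par c r) (b_par b r) (\<gamma> r) (blue r + n) x"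

definition weight_on :: "nat \<Rightarrow> nat \<Rightarrow> real" where
  "weight_on r x = hahn_weight (a_par c r) (b_par b r) (\<gamma> r) x"

text \<open>The weight of a line is split into a factor for functions of the end point and a factor for functions
of the starting point of a path. This is the split for which the transition from line to line has
all coefficients \<open>1\<close>. For \<open>r \<le> b\<close> the end point carries the full weight, for \<open>r \<ge> c\<close> none of it.\<close>

definition right_weight :: "nat \<Rightarrow> nat \<Rightarrow> real" where
  "right_weight r x = (if r \<le> c then fact (\<gamma> r + a_par c r - x) / fact (\<gamma> r - x) else 1) *
     (if r \<le> b then fact (b_par b r + x) / fact x else 1)"

text \<open>The product of the factors that the ladder operators produce on the way to line \<open>r\<close>, up to a
constant depending only on \<open>n\<close>: the square root in the kernel is
\<open>norming n s / norming n r\<close>.\<close>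

definition norming :: "int \<Rightarrow> nat \<Rightarrow> real" where
  "norming n r = sqrt (fact (nat (int r + n)) / fact (nat (int b + int c - int r + n)))"

definition right_fun :: "int \<Rightarrow> nat \<Rightarrow> nat \<Rightarrow> real" where
  "right_fun n r x = norming n r * ((-1) ^ x * hahn_on n r x * right_weight r x)"

definition left_fun :: "int \<Rightarrow> nat \<Rightarrow> nat \<Rightarrow> real" where
  "left_fun n r x = (-1) ^ x * hahn_on n r x * (weight_on r x / right_weight r x) / norming n r"

text \<open>The ratio between the functions \<open>left_fun\<close>, \<open>right_fun\<close>, in which path counts expand without square
roots, and the orthonormal functions of the kernel.\<close>

definition gauge :: "nat \<Rightarrow> nat \<Rightarrow> real" where
  "gauge r x = (-1) ^ x * sqrt (weight_on r x) / right_weight r x"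

lemma right_weight_pos: "right_weight r x > 0"
  by (simp add: right_weight_def)

lemma weight_on_pos: "weight_on r x > 0"
  by (simp add: weight_on_def hahn_weight_pos)

lemma norming_pos: "norming n r > 0"
  by (simp add: norming_def)

lemma gauge_nonzero: "gauge r x \<noteq> 0"
  using right_weight_pos[of r x] weight_on_pos[of r x] by (simp add: gauge_def)

lemma blue_eq:
  assumes "r \<le> b + c"
  shows "blue r = (if r \<le> b then int r else if r \<le> c then int b else int b + int c - int r)"
  using assms a_pos b_le_c by (auto simp: blue_count_def gamma_line_def)

lemma norming_Suc:
  assumes "int r + n \<ge> 0" and "int b + int c - int r + n \<ge> 1"
  shows "norming n (Suc r) = norming n r * sqrt (of_int (int r + 1 + n) * of_int (int b + int c - int r + n))"
proof -
  define j where "j = nat (int r + n)"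
  define k where "k = nat (int b + int c - int r + n - 1)"
  have n: "nat (int (Suc r) + n) = Suc j" "nat (int b + int c - int (Suc r) + n) = k"
    "nat (int b + int c - int r + n) = Suc k" "int r + 1 + n = int (Suc j)" "int b + int c - int r + n = int (Suc k)"
    using assms by (auto simp: j_def k_def)
  have "norming n (Suc r) = sqrt (fact (Suc j) / fact k)" by (simp only: norming_def n)
  also have "(fact (Suc j) / fact k :: real) = fact j / fact (Suc k) * (real (Suc j) * real (Suc k))"
    by (simp add: divide_simps del: of_nat_Suc)
  finally show ?thesis unfolding norming_def n j_def[symmetric] by (simp only: real_sqrt_mult of_int_of_nat_eq nat_int)
qed

lemma hahn_on_nonneg: "blue r + n \<ge> 0 \<Longrightarrow>
    hahn_on n r x = poly (hahn_poly (a_par c r) (b_par b r) (\<gamma> r) (nat (blue r + n))) (real x)"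
  by (simp add: hahn_on_def hahn_def)

lemma hahn_on_neg: "blue r + n < 0 \<Longrightarrow> hahn_on n r x = 0"
  by (simp add: hahn_on_def hahn_def)

lemma left_right_fun_neg: "blue r + n < 0 \<Longrightarrow> right_fun n r x = 0" "blue r + n < 0 \<Longrightarrow> left_fun n r x = 0"
  by (simp_all add: right_fun_def left_fun_def hahn_on_neg)

text \<open>Position \<open>y\<close> on line \<open>r + 1\<close> is reached from the positions \<open>y - 1\<close> and \<open>y\<close> of line \<open>r\<close> as long as the
lower boundary of the hexagon descends, and from \<open>y\<close> and \<open>y + 1\<close> when it ascends.\<close>

definition from_neighbours :: "nat \<Rightarrow> (nat \<Rightarrow> real) \<Rightarrow> nat \<Rightarrow> real" where
  "from_neighbours r f y = (if y \<le> \<gamma> r then f y else 0) +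
     (if r < b then (if 1 \<le> y then f (y - 1) else 0) else (if Suc y \<le> \<gamma> r then f (Suc y) else 0))"

lemma right_fun_step_rising:
  assumes r: "r < b" and y: "y \<le> \<gamma> (Suc r)" and n: "n \<le> int a - 1" and pos: "int r + n \<ge> 0"
  shows "from_neighbours r (right_fun n r) y = right_fun n (Suc r) y"
proof -
  define M where "M = \<gamma> r"
  define \<alpha> where "\<alpha> = c - Suc r"
  define \<beta> where "\<beta> = b - Suc r"
  define k where "k = nat (int r + n)"
  have par: "a_par c r = Suc \<alpha>" "b_par b r = Suc \<beta>" "a_par c (Suc r) = \<alpha>" "b_par b (Suc r) = \<beta>"
    "\<gamma> (Suc r) = Suc M"
    using r b_le_c a_pos by (auto simp: a_par_def b_par_def \<alpha>_def \<beta>_def M_def gamma_line_def)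
  have bl: "blue r = int r" "blue (Suc r) = int r + 1" using r b_le_c by (auto simp: blue_eq)
  have k: "nat (blue r + n) = k" "nat (blue (Suc r) + n) = Suc k" "k \<le> M"
    using pos n r by (auto simp: bl k_def M_def gamma_line_def)
  define p where "p = hahn_poly (Suc \<alpha>) (Suc \<beta>) M k"
  define p' where "p' = hahn_poly \<alpha> \<beta> (Suc M) (Suc k)"
  define s where "s = sqrt (real (Suc k) * real (\<alpha> + \<beta> + 2 + k))"
  have h: "hahn_on n r x = poly p (real x)" "hahn_on n (Suc r) x = poly p' (real x)" for x
    using pos by (simp_all add: hahn_on_nonneg bl p_def p'_def k[unfolded bl] par M_def[symmetric])
  have w: "right_weight r x = hahn_weight (Suc \<alpha>) (Suc \<beta>) M x"
    "right_weight (Suc r) x = hahn_weight \<alpha> \<beta> (Suc M) x" for x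
    using r b_le_c by (simp_all add: right_weight_def hahn_weight_def par M_def[symmetric])
  have s: "norming n (Suc r) = norming n r * s"
  proof -
    have "real_of_int (int r + 1 + n) = real (Suc k)" "real_of_int (int b + int c - int r + n) = real (\<alpha> + \<beta> + 2 + k)"
      using pos r b_le_c by (auto simp: k_def \<alpha>_def \<beta>_def)
    moreover have "int b + int c - int r + n \<ge> 1" using pos r b_le_c by auto
    ultimately show ?thesis using norming_Suc[of r n] pos unfolding s_def by (simp only:)
  qed
  have e: "poly (hahn_raise \<alpha> \<beta> (Suc M) p) x = s * poly p' x" for x
    unfolding p_def p'_def s_def by (simp only: hahn_raise_hahn_poly[OF k(3)] poly_smult)
  have sgn: "1 \<le> y \<Longrightarrow> (-1) ^ (y - 1) = - ((-1 :: real) ^ y)" by (cases y) auto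
  have "from_neighbours r (right_fun n r) y = norming n r * (-1) ^ y *
      ((if y \<le> M then hahn_weight (Suc \<alpha>) (Suc \<beta>) M y * poly p (real y) else 0)
       - (if 1 \<le> y then hahn_weight (Suc \<alpha>) (Suc \<beta>) M (y - 1) * poly p (real (y - 1)) else 0))"
    using r sgn by (simp add: from_neighbours_def right_fun_def h w M_def[symmetric] algebra_simps)
  also have "\<dots> = norming n r * (-1) ^ y * (hahn_weight \<alpha> \<beta> (Suc M) y * (s * poly p' (real y)))"
    using y by (subst hahn_raise_transition) (simp_all add: par e)
  also have "\<dots> = right_fun n (Suc r) y"
    by (simp add: right_fun_def h w s algebra_simps)
  finally show ?thesis .
qed

lemma right_fun_step_middle:
  assumes r: "b \<le> r" "r < c" and y: "y \<le> \<gamma> (Suc r)" and n: "n \<le> int a - 1" and pos: "int b + n \<ge> 0"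
  shows "from_neighbours r (right_fun n r) y = right_fun n (Suc r) y"
proof -
  define M where "M = \<gamma> r"
  define \<alpha> where "\<alpha> = c - Suc r"
  define \<beta> where "\<beta> = r - b"
  define k where "k = nat (int b + n)"
  have par: "a_par c r = Suc \<alpha>" "b_par b r = \<beta>" "a_par c (Suc r) = \<alpha>" "b_par b (Suc r) = Suc \<beta>"
    "\<gamma> (Suc r) = M"
    using r a_pos by (auto simp: a_par_def b_par_def \<alpha>_def \<beta>_def M_def gamma_line_def)
  have bl: "blue r = int b" "blue (Suc r) = int b" using r by (auto simp: blue_eq)
  have k: "nat (blue r + n) = k" "nat (blue (Suc r) + n) = k" "k \<le> M"
    using pos n r by (auto simp: bl k_def M_def gamma_line_def)
  define p where "p = hahn_poly (Suc \<alpha>) \<beta> M k"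
  define p' where "p' = hahn_poly \<alpha> (Suc \<beta>) M k"
  define s where "s = sqrt (real (\<alpha> + 1 + k) * real (\<beta> + 1 + k))"
  have h: "hahn_on n r x = poly p (real x)" "hahn_on n (Suc r) x = poly p' (real x)" for x
    using pos by (simp_all add: hahn_on_nonneg bl p_def p'_def k[unfolded bl] par M_def[symmetric])
  have w: "right_weight r x = fact (M + Suc \<alpha> - x) / fact (M - x)"
    "right_weight (Suc r) x = fact (M + \<alpha> - x) / fact (M - x)" for x
    unfolding right_weight_def par M_def[symmetric] using r by (auto simp: \<beta>_def)
  have s: "norming n (Suc r) = norming n r * s"
  proof -
    have "real_of_int (int r + 1 + n) = real (\<beta> + 1 + k)" "real_of_int (int b + int c - int r + n) = real (\<alpha> + 1 + k)"
      using pos r by (auto simp: k_def \<alpha>_def \<beta>_def)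
    moreover have "int b + int c - int r + n \<ge> 1" "int r + n \<ge> 0" using pos r by auto
    ultimately show ?thesis using norming_Suc[of r n] unfolding s_def by (simp only: mult.commute)
  qed
  have e: "poly (hahn_shift (Suc \<alpha>) M p) x = s * poly p' x" for x
    unfolding p_def p'_def s_def by (simp only: hahn_shift_hahn_poly[OF k(3)] poly_smult)
  have "from_neighbours r (right_fun n r) y = norming n r * (-1) ^ y *
      (fact (M + Suc \<alpha> - y) / fact (M - y) * poly p (real y)
       - (if Suc y \<le> M then fact (M + Suc \<alpha> - Suc y) / fact (M - Suc y) * poly p (real (Suc y)) else 0))"
    using r y by (simp add: from_neighbours_def right_fun_def h w par M_def[symmetric] algebra_simps)
  also have "\<dots> = norming n r * (-1) ^ y * (fact (M + \<alpha> - y) / fact (M - y) * (s * poly p' (real y)))"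
    using y by (subst hahn_shift_transition) (simp_all add: par e)
  also have "\<dots> = right_fun n (Suc r) y"
    by (simp add: right_fun_def h w s algebra_simps)
  finally show ?thesis .
qed

lemma right_fun_step_falling:
  assumes r: "c \<le> r" "r < b + c" and y: "y \<le> \<gamma> (Suc r)" and n: "n \<le> int a - 1"
    and pos: "int b + int c - int r + n \<ge> 0"
  shows "from_neighbours r (right_fun n r) y = right_fun n (Suc r) y"
proof -
  define M where "M = \<gamma> (Suc r)"
  define \<alpha> where "\<alpha> = r - c"
  define \<beta> where "\<beta> = r - b"
  define k where "k = nat (int b + int c - int r + n)"
  have par: "a_par c r = \<alpha>" "b_par b r = \<beta>" "a_par c (Suc r) = Suc \<alpha>" "b_par b (Suc r) = Suc \<beta>"
    "\<gamma> r = Suc M"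
    using r a_pos b_le_c by (auto simp: a_par_def b_par_def \<alpha>_def \<beta>_def M_def gamma_line_def)
  have bl: "blue r = int b + int c - int r" "blue (Suc r) = int b + int c - int r - 1"
    using r b_le_c by (auto simp: blue_eq)
  have k: "nat (blue r + n) = k" "k \<le> Suc M"
    using pos n r b_le_c by (auto simp: bl k_def M_def gamma_line_def)
  define p where "p = hahn_poly \<alpha> \<beta> (Suc M) k"
  have h: "hahn_on n r x = poly p (real x)" for x
    using pos by (simp_all add: hahn_on_nonneg bl p_def k[unfolded bl] par)
  have w: "right_weight r x = 1" "right_weight (Suc r) x = 1" for x
    unfolding right_weight_def par using r b_le_c by (auto simp: \<alpha>_def \<beta>_def)
  have "from_neighbours r (right_fun n r) y = norming n r * (-1) ^ y * poly (hahn_lower p) (real y)"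
    using r y b_le_c by (simp add: from_neighbours_def right_fun_def h w par M_def[symmetric] poly_hahn_lower algebra_simps)
  also have "\<dots> = right_fun n (Suc r) y"
  proof (cases k)
    case 0
    then have "right_fun n (Suc r) y = 0" using pos by (intro left_right_fun_neg) (auto simp: bl k_def)
    then show ?thesis using 0 by (simp add: p_def hahn_lower_hahn_poly_0)
  next
    case (Suc j)
    define s where "s = sqrt (real (Suc j) * real (\<alpha> + \<beta> + 2 + j))"
    have "nat (blue (Suc r) + n) = j" "blue (Suc r) + n \<ge> 0" "j \<le> M" using Suc k(2) by (auto simp: bl k_def)
    then have h': "hahn_on n (Suc r) x = poly (hahn_poly (Suc \<alpha>) (Suc \<beta>) M j) (real x)" for x
      by (simp add: hahn_on_nonneg par M_def[symmetric])
    have e: "poly (hahn_lower p) x = s * poly (hahn_poly (Suc \<alpha>) (Suc \<beta>) M j) x" for x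
      unfolding p_def s_def Suc by (simp only: hahn_lower_hahn_poly[OF \<open>j \<le> M\<close>] poly_smult)
    have s: "norming n (Suc r) = norming n r * s"
    proof -
      have "real_of_int (int r + 1 + n) = real (\<alpha> + \<beta> + 2 + j)" "real_of_int (int b + int c - int r + n) = real (Suc j)"
        using pos r b_le_c Suc by (auto simp: k_def \<alpha>_def \<beta>_def)
      moreover have "int b + int c - int r + n \<ge> 1" "int r + n \<ge> 0" using Suc r b_le_c by (auto simp: k_def)
      ultimately show ?thesis using norming_Suc[of r n] unfolding s_def by (simp only: mult.commute)
    qed
    show ?thesis by (simp add: right_fun_def h' w e s algebra_simps)
  qed
  finally show ?thesis .
qed

section \<open>Path counts in the Hahn basis\<close>

abbreviation degrees :: "int set" where "degrees \<equiv> {- int b..int a - 1}"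

text \<open>The exceptional \<open>n\<close> is the one of degree zero on a line \<open>r + 1 \<le> b\<close>: there the number of points
grows, and this basis function is orthogonal to everything that comes from line \<open>r\<close>.\<close>

lemma right_fun_step:
  assumes r: "r < b + c" and y: "y \<le> \<gamma> (Suc r)" and n: "n \<le> int a - 1"
    and pos: "blue r + n \<ge> 0 \<or> blue (Suc r) + n < 0"
  shows "from_neighbours r (right_fun n r) y = right_fun n (Suc r) y"
proof (cases "blue r + n \<ge> 0")
  case True
  consider "r < b" | "b \<le> r" "r < c" | "c \<le> r" by linarith
  then show ?thesis
  proof cases
    case 1
    with True b_le_c show ?thesis by (intro right_fun_step_rising y n) (auto simp: blue_eq)
  next
    case 2
    with True show ?thesis by (intro right_fun_step_middle y n) (auto simp: blue_eq split: if_splits)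
  next
    case 3
    with True r b_le_c show ?thesis
      by (intro right_fun_step_falling y n) (auto simp: blue_eq split: if_splits)
  qed
next
  case False
  with pos have "right_fun n r x = 0" "right_fun n (Suc r) x = 0" for x
    by (auto intro: left_right_fun_neg)
  then show ?thesis by (simp add: from_neighbours_def)
qed

lemma blue_mono: "r \<le> s \<Longrightarrow> s \<le> b \<Longrightarrow> blue r \<le> blue s"
  using b_le_c by (simp add: blue_eq)

lemma blue_bounds: "r \<le> b + c \<Longrightarrow> 0 \<le> blue r" "r \<le> b + c \<Longrightarrow> blue r \<le> int b"
  using b_le_c by (auto simp: blue_eq)

lemma gamma_blue: "int (\<gamma> r) = blue r + int a - 1"
  using a_pos by (simp add: blue_count_def)

text \<open>Apart from factors depending only on \<open>x\<close> and \<open>y\<close>, this is \<open>hahn_poly_complete\<close> with the degrees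
shifted by the number of blue dots; the remaining indices contribute zero.\<close>

lemma line_completeness:
  assumes r: "r \<le> b + c" and x: "x \<le> \<gamma> r" and y: "y \<le> \<gamma> r"
  shows "(\<Sum>n\<in>degrees. left_fun n r x * right_fun n r y) = of_bool (x = y)"
proof -
  let ?q = "\<lambda>k x. poly (hahn_poly (a_par c r) (b_par b r) (\<gamma> r) k) (real x)"
  let ?c = "(-1) ^ x * (-1) ^ y * right_weight r y / right_weight r x"
  have "(\<Sum>n\<in>degrees. hahn_on n r x * hahn_on n r y) = (\<Sum>n\<in>{- blue r..int a - 1}. hahn_on n r x * hahn_on n r y)"
    using blue_bounds[OF r] by (intro sum.mono_neutral_right) (auto intro: hahn_on_neg)
  also have "\<dots> = (\<Sum>k=0..\<gamma> r. ?q k x * ?q k y)"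
    using gamma_blue[of r] blue_bounds[OF r]
    by (intro sum.reindex_bij_witness[where i = "\<lambda>k. int k - blue r" and j = "\<lambda>n. nat (blue r + n)"])
      (auto simp: hahn_on_nonneg)
  finally have q: "(\<Sum>n\<in>degrees. hahn_on n r x * hahn_on n r y) = (\<Sum>k=0..\<gamma> r. ?q k x * ?q k y)" .
  have "left_fun n r x * right_fun n r y = ?c * weight_on r x * (hahn_on n r x * hahn_on n r y)" for n
    using norming_pos[of n r] by (simp add: left_fun_def right_fun_def)
  then have "(\<Sum>n\<in>degrees. left_fun n r x * right_fun n r y)
      = ?c * weight_on r x * (\<Sum>n\<in>degrees. hahn_on n r x * hahn_on n r y)"
    by (simp only: sum_distrib_left)
  also have "\<dots> = ?c * (\<Sum>k=0..\<gamma> r. ?q k y * (?q k x * weight_on r x))"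
    unfolding q by (simp only: sum_distrib_left mult.assoc) (intro sum.cong, auto)
  also have "(\<Sum>k=0..\<gamma> r. ?q k y * (?q k x * weight_on r x)) = of_bool (y = x)"
    unfolding weight_on_def using hahn_poly_complete[OF y x, of "a_par c r" "b_par b r"] by simp
  finally show ?thesis using right_weight_pos[of r x] by (auto simp: power_mult_distrib[symmetric])
qed

lemma pt_in_Lambda: "r \<le> b + c \<Longrightarrow> x \<le> \<gamma> r \<Longrightarrow> pt r x \<in> \<Lambda>"
  by (auto simp: pt_def Lambda_set_def)

lemma Lambda_index_range: "(r, alpha_line b r + 2 * z) \<in> \<Lambda> \<Longrightarrow> 0 \<le> z \<and> z \<le> int (\<gamma> r)"
  by (auto simp: Lambda_set_def)

lemma paths_in_Lambda_Suc:
  assumes r: "r < b + c" and y: "y \<le> \<gamma> (Suc r)" and p: "fst p \<le> r"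
  shows "paths_in \<Lambda> p (Suc r) (alpha_line b (Suc r) + 2 * int y) =
    from_neighbours r (\<lambda>x. paths_in \<Lambda> p r (alpha_line b r + 2 * int x)) y"
proof -
  let ?f = "\<lambda>z. paths_in \<Lambda> p r (alpha_line b r + 2 * z)"
  have f: "?f z = 0" if "\<not> (0 \<le> z \<and> z \<le> int (\<gamma> r))" for z
    using Lambda_index_range[of r z] that by (intro paths_in_outside) blast
  have "(Suc r, alpha_line b (Suc r) + 2 * int y) \<in> \<Lambda>"
    using pt_in_Lambda[of "Suc r" y] r y by (simp add: pt_def)
  moreover have "p \<noteq> (Suc r, z)" for z using p by auto
  ultimately have eq: "paths_in \<Lambda> p (Suc r) (alpha_line b (Suc r) + 2 * int y) =
      paths_in \<Lambda> p r (alpha_line b (Suc r) + 2 * int y - 1) + paths_in \<Lambda> p r (alpha_line b (Suc r) + 2 * int y + 1)"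
    by simp
  show ?thesis
  proof (cases "r < b")
    case True
    then have al: "alpha_line b (Suc r) + 2 * int y - 1 = alpha_line b r + 2 * (int y - 1)"
      "alpha_line b (Suc r) + 2 * int y + 1 = alpha_line b r + 2 * int y"
      by (simp_all add: alpha_line_def)
    have "int y - 1 = int (y - 1)" if "1 \<le> y" using that by simp
    then have "?f (int y - 1) = (if 1 \<le> y then ?f (int (y - 1)) else 0)" using f[of "int y - 1"] by auto
    moreover have "?f (int y) = (if y \<le> \<gamma> r then ?f (int y) else 0)" using f[of "int y"] by auto
    ultimately show ?thesis unfolding eq al from_neighbours_def using True by simp
  next
    case False
    then have al: "alpha_line b (Suc r) + 2 * int y - 1 = alpha_line b r + 2 * int y"
      "alpha_line b (Suc r) + 2 * int y + 1 = alpha_line b r + 2 * int (Suc y)"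
      by (auto simp: alpha_line_def)
    have "?f (int (Suc y)) = (if Suc y \<le> \<gamma> r then ?f (int (Suc y)) else 0)" using f[of "int (Suc y)"] by auto
    moreover have "?f (int y) = (if y \<le> \<gamma> r then ?f (int y) else 0)" using f[of "int y"] by auto
    ultimately show ?thesis unfolding eq al from_neighbours_def using False by simp
  qed
qed

lemma gamma_Suc_rising: "r < b \<Longrightarrow> \<gamma> (Suc r) = Suc (\<gamma> r)"
  using a_pos by (simp add: gamma_line_def)

lemma from_neighbours_sum:
  "from_neighbours r (\<lambda>z. \<Sum>n\<in>I. l n * f n z) y = (\<Sum>n\<in>I. l n * from_neighbours r (f n) y)"
  by (simp add: from_neighbours_def distrib_left sum.distrib)

lemma from_neighbours_cong:
  assumes "y \<le> \<gamma> (Suc r)" and "\<And>z. z \<le> \<gamma> r \<Longrightarrow> f z = g z"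
  shows "from_neighbours r f y = from_neighbours r g y"
  using assms gamma_Suc_rising[of r] by (auto simp: from_neighbours_def)

text \<open>Induction on the end line, by pushing \<open>right_fun\<close> forward one line at a time. When a new basis
function appears on line \<open>s + 1\<close>, its partner on the earlier line \<open>r\<close> has negative degree.\<close>

lemma paths_expansion:
  assumes "r \<le> s" and "s \<le> b + c" and x: "x \<le> \<gamma> r" and "y \<le> \<gamma> s"
  shows "paths_in \<Lambda> (pt r x) s (alpha_line b s + 2 * int y) = (\<Sum>n\<in>degrees. left_fun n r x * right_fun n s y)"
  using assms(1,2,4)
proof (induction s arbitrary: y rule: dec_induct)
  case base
  have "paths_in \<Lambda> (pt r x) (fst (pt r x)) (alpha_line b r + 2 * int y) = of_bool (x = y)"
    unfolding paths_in_same_time using pt_in_Lambda[of r x] base x by (auto simp: pt_def)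
  then show ?case using line_completeness[OF base(1) x base(2)] by (simp add: pt_def)
next
  case (step s)
  have s: "s < b + c" using step.prems by simp
  have "fst (pt r x) \<le> s" using step.hyps by (simp add: pt_def)
  note Suc = paths_in_Lambda_Suc[OF s step.prems(2) this]
  have "paths_in \<Lambda> (pt r x) (Suc s) (alpha_line b (Suc s) + 2 * int y) =
      from_neighbours s (\<lambda>z. \<Sum>n\<in>degrees. left_fun n r x * right_fun n s z) y"
    unfolding Suc using s by (intro from_neighbours_cong step.prems step.IH) auto
  also have "\<dots> = (\<Sum>n\<in>degrees. left_fun n r x * from_neighbours s (right_fun n s) y)"
    by (rule from_neighbours_sum)
  also have "\<dots> = (\<Sum>n\<in>degrees. left_fun n r x * right_fun n (Suc s) y)"
  proof (intro sum.cong refl)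
    fix n assume n: "n \<in> degrees"
    show "left_fun n r x * from_neighbours s (right_fun n s) y = left_fun n r x * right_fun n (Suc s) y"
    proof (cases "blue s + n \<ge> 0 \<or> blue (Suc s) + n < 0")
      case True
      then show ?thesis using right_fun_step[OF s step.prems(2)] n by simp
    next
      case False
      then have "blue s < blue (Suc s)" by linarith
      then have "s < b" using s b_le_c by (auto simp: blue_eq split: if_splits)
      then have "blue r + n < 0" using blue_mono[of r s] step.hyps(1) False by simp
      then show ?thesis by (simp add: left_right_fun_neg)
    qed
  qed
  finally show ?case .
qed

lemma kernel_term_eq:
  "kernel_term a b c n r x s y = left_fun n r x * right_fun n s y * gauge s y / gauge r x"
proof -
  have sq: "sqrt (weight_on r x) * sqrt (weight_on r x) = weight_on r x" for r x
    using weight_on_pos[of r x] by simp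
  have 1: "left_fun n r x / gauge r x = hahn_on n r x * sqrt (weight_on r x) / norming n r" for r x
    using weight_on_pos[of r x] right_weight_pos[of r x] sq[of r x]
    by (simp add: left_fun_def gauge_def divide_simps)
  have 2: "right_fun n s y * gauge s y = norming n s * hahn_on n s y * sqrt (weight_on s y)" for s y
    using right_weight_pos[of s y] by (simp add: right_fun_def gauge_def power_mult_distrib[symmetric])
  have "left_fun n r x * right_fun n s y * gauge s y / gauge r x =
      (left_fun n r x / gauge r x) * (right_fun n s y * gauge s y)" by simp
  also have "\<dots> = kernel_term a b c n r x s y"
    unfolding 1 2 kernel_term_def hahn_on_def[symmetric] weight_on_def[symmetric] norming_def
    by (simp add: real_sqrt_mult real_sqrt_divide)
  finally show ?thesis by simp
qed

text \<open>The kernel before conjugation: paths from \<open>p\<close> to \<open>q\<close>, corrected by the part of the expansion that the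
matrix of paths from the start points to the end points sees.\<close>

definition paths_kernel :: "nat \<Rightarrow> nat \<Rightarrow> nat \<Rightarrow> nat \<Rightarrow> real" where
  "paths_kernel r x s y = paths_in \<Lambda> (pt r x) s (alpha_line b s + 2 * int y)
     - (\<Sum>n=0..int a - 1. left_fun n r x * right_fun n s y)"

lemma blue_kernel_eq:
  assumes "r \<le> b + c" and "x \<le> \<gamma> r" and "s \<le> b + c" and "y \<le> \<gamma> s"
  shows "blue_kernel a b c r x s y = paths_kernel r x s y * gauge s y / gauge r x"
proof (cases "r \<le> s")
  case True
  have "(\<Sum>\<^sub>\<infinity>n\<in>{..-1}. kernel_term a b c n r x s y) = (\<Sum>\<^sub>\<infinity>n\<in>{-int b..-1}. kernel_term a b c n r x s y)"
  proof (rule infsum_cong_neutral)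
    fix n assume "n \<in> {..-1} - {-int b..-1}"
    then have "blue r + n < 0" using blue_bounds[OF assms(1)] by auto
    then show "kernel_term a b c n r x s y = 0" by (simp add: kernel_term_eq left_right_fun_neg)
  qed auto
  also have "\<dots> = (\<Sum>n\<in>{-int b..-1}. left_fun n r x * right_fun n s y) * gauge s y / gauge r x"
    by (simp add: kernel_term_eq sum_distrib_right sum_divide_distrib)
  also have "(\<Sum>n\<in>{-int b..-1}. left_fun n r x * right_fun n s y) = paths_kernel r x s y"
  proof -
    have "degrees = {-int b..-1} \<union> {0..int a - 1}" by auto
    then have "(\<Sum>n\<in>degrees. left_fun n r x * right_fun n s y) =
      (\<Sum>n\<in>{-int b..-1}. left_fun n r x * right_fun n s y) + (\<Sum>n=0..int a - 1. left_fun n r x * right_fun n s y)"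
      by (simp only:) (rule sum.union_disjoint, auto)
    then show ?thesis using paths_expansion[OF True assms(3,2,4)] by (simp add: paths_kernel_def)
  qed
  finally show ?thesis using True by (simp add: blue_kernel_def)
next
  case False
  then have "paths_in \<Lambda> (pt r x) s (alpha_line b s + 2 * int y) = 0"
    by (intro paths_in_before) (simp add: pt_def)
  then show ?thesis using False
    by (simp add: blue_kernel_def paths_kernel_def kernel_term_eq sum_distrib_right sum_divide_distrib sum_negf)
qed

section \<open>The blue dots\<close>

definition last_height :: "nat \<Rightarrow> int" where
  "last_height i = int c - int b + 2 * int i"

definition index :: "nat \<times> int \<Rightarrow> nat" where
  "index p = nat ((snd p - alpha_line b (fst p)) div 2)"

lemma pt_index:
  assumes "p \<in> \<Lambda>"
  shows "pt (fst p) (index p) = p" and "fst p \<le> b + c" and "index p \<le> \<gamma> (fst p)"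
  using assms by (auto simp: Lambda_set_def pt_def index_def)

text \<open>The hexagon consists of the points that have the right parity and are not too far from the start
and end points.\<close>

lemma walk_in_Lambda:
  assumes w: "w \<in> walk_families a b c" and i: "i < a" and t: "t \<le> b + c"
  shows "(t, w i t) \<in> \<Lambda>"
proof -
  have s: "w i (Suc t) = w i t + 1 \<or> w i (Suc t) = w i t - 1" if "t < b + c" for t
    using w i that by (simp add: walk_families_def)
  have e: "w i 0 = 2 * int i" "w i (b + c) = int c - int b + 2 * int i"
    using w i by (simp_all add: walk_families_def)
  \<comment> \<open>\<open>lo\<close> compares with the start point, \<open>hi\<close> with the end point of the walk.\<close>
  note lo = unit_steps_bounds[of "b + c" "w i" 0 t, OF s _ t]
  note hi = unit_steps_bounds[of "b + c" "w i" t "b + c", OF s t]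
  define k where "k = nat ((w i t - alpha_line b t) div 2)"
  have ev: "even (w i t - alpha_line b t)" using lo e by (auto simp: alpha_line_def)
  have ge: "w i t \<ge> alpha_line b t" using lo hi e t i by (auto simp: alpha_line_def)
  have le: "w i t \<le> alpha_line b t + 2 * int (\<gamma> t)"
    using lo hi e t i a_pos b_le_c by (auto simp: alpha_line_def gamma_line_def)
  have "w i t = alpha_line b t + 2 * int k" using ev ge by (simp add: k_def)
  moreover from this le have "k \<le> \<gamma> t" by simp
  ultimately show ?thesis using t by (auto simp: Lambda_set_def)
qed

lemma walks_with_blue_points:
  assumes "S \<subseteq> \<Lambda>"
  shows "{w \<in> walk_families a b c. S \<subseteq> blue_dots a b c w} = walks_to (\<Lambda> - S) a (b + c) last_height"
proof (intro equalityI subsetI)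
  fix w assume "w \<in> {w \<in> walk_families a b c. S \<subseteq> blue_dots a b c w}"
  then have w: "w \<in> walk_families a b c" and S: "S \<subseteq> blue_dots a b c w" by auto
  have "(t, w i t) \<in> \<Lambda> - S" if "i < a" "t \<le> b + c" for i t
    using walk_in_Lambda[OF w that] S that by (fastforce simp: blue_dots_def red_dots_def)
  then show "w \<in> walks_to (\<Lambda> - S) a (b + c) last_height"
    using w by (simp add: walk_families_def walks_to_def last_height_def)
next
  fix w assume w: "w \<in> walks_to (\<Lambda> - S) a (b + c) last_height"
  then have "w \<in> walk_families a b c"
    by (auto simp: walk_families_def walks_to_def last_height_def)
  moreover have "p \<in> blue_dots a b c w" if p: "p \<in> S" for p
  proof -
    have "p \<in> \<Lambda>" using p assms by blast
    moreover have "w i (fst p) \<noteq> snd p" if "i < a" for i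
      using walks_toD(5)[OF w that pt_index(2)[OF \<open>p \<in> \<Lambda>\<close>]] p by auto
    ultimately show ?thesis by (cases p) (simp add: blue_dots_def red_dots_def)
  qed
  ultimately show "w \<in> {w \<in> walk_families a b c. S \<subseteq> blue_dots a b c w}" by blast
qed

lemma card_walks:
  "finite (walks_to A a (b + c) last_height)"
  "real (card (walks_to A a (b + c) last_height)) =
    Determinant.det (Matrix.mat a a (\<lambda>(i, j). paths_in A (0, 2 * int i) (b + c) (last_height j)))"
proof -
  have km: "finite (walks_to A a (b + c) last_height) \<and> real (card (walks_to A a (b + c) last_height)) =
    Determinant.det (Matrix.mat a a (\<lambda>(i, j). paths_in A (0, 2 * int j) (b + c) (last_height i)))"
    by (rule karlin_mcgregor) (auto simp: last_height_def)
  then show "finite (walks_to A a (b + c) last_height)" by simp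
  have "Matrix.mat a a (\<lambda>(i, j). paths_in A (0, 2 * int i) (b + c) (last_height j)) =
      transpose_mat (Matrix.mat a a (\<lambda>(i, j). paths_in A (0, 2 * int j) (b + c) (last_height i)))"
    by (intro eq_matI) auto
  then show "real (card (walks_to A a (b + c) last_height)) =
    Determinant.det (Matrix.mat a a (\<lambda>(i, j). paths_in A (0, 2 * int i) (b + c) (last_height j)))"
    using km by (simp only: det_transpose[OF mat_carrier])
qed

lemma red_degrees: "(\<Sum>n=0..int a - 1. f n) = (\<Sum>k<a. f (int k))" for f :: "int \<Rightarrow> real"
  by (rule sum.reindex_bij_witness[where i = int and j = nat]) auto

lemma boundary_lines:
  "pt 0 i = (0, 2 * int i)" "last_height j = alpha_line b (b + c) + 2 * int j"
  "blue 0 = 0" "blue (b + c) = 0" "\<gamma> 0 = a - 1" "\<gamma> (b + c) = a - 1"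
  using a_pos b_pos b_le_c by (auto simp: pt_def alpha_line_def last_height_def gamma_line_def blue_count_def)

text \<open>On a line without blue dots the degree is \<open>n\<close> itself, so negative \<open>n\<close> drop out.\<close>

lemma boundary_degrees:
  assumes "blue r = 0 \<or> blue s = 0"
  shows "(\<Sum>n\<in>degrees. left_fun n r x * right_fun n s y) = (\<Sum>k<a. left_fun (int k) r x * right_fun (int k) s y)"
proof -
  have "(\<Sum>n\<in>degrees. left_fun n r x * right_fun n s y) = (\<Sum>n=0..int a - 1. left_fun n r x * right_fun n s y)"
    using assms by (intro sum.mono_neutral_right) (auto simp: left_right_fun_neg)
  then show ?thesis by (simp only: red_degrees)
qed

lemma mult_mat_entry:
  "i < m \<Longrightarrow> j < l \<Longrightarrow> (Matrix.mat m n f * Matrix.mat n l g) $$ (i, j) = (\<Sum>k<n. f (i, k) * g (k, j))"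
  for f g :: "nat \<times> nat \<Rightarrow> real"
  by (simp add: scalar_prod_def atLeast0LessThan)

definition start_mat :: "real mat" where
  "start_mat = Matrix.mat a a (\<lambda>(i, k). left_fun (int k) 0 i)"

definition end_mat :: "real mat" where
  "end_mat = Matrix.mat a a (\<lambda>(k, j). right_fun (int k) (b + c) j)"

text \<open>The first and the last line have exactly \<open>a\<close> points, so there the \<open>a\<close> remaining functions form a
basis; the inverses consist of the dual functions.\<close>

lemma boundary_mats_invertible: "Determinant.det start_mat \<noteq> 0" "Determinant.det end_mat \<noteq> 0"
proof -
  have comp: "(\<Sum>k<a. left_fun (int k) r i * right_fun (int k) r j) = of_bool (i = j)"
    if "r = 0 \<or> r = b + c" "i < a" "j < a" for r i j
  proof -
    have g: "blue r = 0" "\<gamma> r = a - 1" using that(1) boundary_lines by auto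
    have "(\<Sum>n\<in>degrees. left_fun n r i * right_fun n r j) = of_bool (i = j)"
      using that by (intro line_completeness) (auto simp: g(2))
    then show ?thesis using boundary_degrees[of r r] g(1) by simp
  qed
  have "start_mat * Matrix.mat a a (\<lambda>(k, j). right_fun (int k) 0 j) = 1\<^sub>m a"
    unfolding start_mat_def by (intro eq_matI) (auto simp: mult_mat_entry comp simp del: index_mult_mat(1))
  then have "Determinant.det start_mat * Determinant.det (Matrix.mat a a (\<lambda>(k, j). right_fun (int k) 0 j)) = 1"
    by (subst det_mult[symmetric, where n = a]) (auto simp: start_mat_def)
  then show "Determinant.det start_mat \<noteq> 0" by auto
  have "Matrix.mat a a (\<lambda>(i, k). left_fun (int k) (b + c) i) * end_mat = 1\<^sub>m a"
    unfolding end_mat_def by (intro eq_matI) (auto simp: mult_mat_entry comp simp del: index_mult_mat(1))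
  then have "Determinant.det (Matrix.mat a a (\<lambda>(i, k). left_fun (int k) (b + c) i)) * Determinant.det end_mat = 1"
    by (subst det_mult[symmetric, where n = a]) (auto simp: end_mat_def)
  then show "Determinant.det end_mat \<noteq> 0" by auto
qed

lemma paths_to_point:
  assumes "r \<le> b + c" "x \<le> \<gamma> r" "p \<in> \<Lambda>" "r \<le> fst p"
  shows "paths_in \<Lambda> (pt r x) (fst p) (snd p) = (\<Sum>n\<in>degrees. left_fun n r x * right_fun n (fst p) (index p))"
  using paths_expansion[OF assms(4) pt_index(2)[OF assms(3)] assms(2) pt_index(3)[OF assms(3)]]
    pt_index(1)[OF assms(3)] by (metis pt_def snd_conv)

text \<open>The core of the argument: \<open>det_bordered\<close> for the points of \<open>ps\<close>, bordered by the start and end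
points. Since \<open>start_mat * end_mat\<close> is the matrix of all paths from start to end, the last two
factors are the total number of families, the case of an empty list.\<close>

lemma card_walks_avoiding:
  assumes ps: "distinct ps" "set ps \<subseteq> \<Lambda>"
  shows "real (card (walks_to (\<Lambda> - set ps) a (b + c) last_height)) =
    Determinant.det (Matrix.mat (length ps) (length ps)
      (\<lambda>(i, j). paths_kernel (fst (ps ! i)) (index (ps ! i)) (fst (ps ! j)) (index (ps ! j)))) *
    Determinant.det start_mat * Determinant.det end_mat"
proof -
  let ?n = "length ps" and ?T = "b + c" and ?A = "\<Lambda> - set ps"
  define G where "G = Matrix.mat ?n ?n (\<lambda>(i, j). paths_in \<Lambda> (ps ! i) (fst (ps ! j)) (snd (ps ! j)))"
  define U where "U = Matrix.mat ?n a (\<lambda>(i, k). left_fun (int k) (fst (ps ! i)) (index (ps ! i)))"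
  define V where "V = Matrix.mat a ?n (\<lambda>(k, j). right_fun (int k) (fst (ps ! j)) (index (ps ! j)))"
  define F where "F = Matrix.mat a ?n (\<lambda>(i, j). first_hit ?A (0, 2 * int i) (fst (ps ! j)) (snd (ps ! j)))"
  note defs = G_def U_def V_def F_def start_mat_def end_mat_def
  have in\<Lambda>: "ps ! i \<in> \<Lambda>" if "i < ?n" for i using ps(2) that nth_mem by blast
  have reindex: "(\<Sum>q\<in>set ps. f q) = (\<Sum>k<?n. f (ps ! k))" for f :: "_ \<Rightarrow> real"
    using sum.reindex_bij_betw[OF bij_betw_nth[OF ps(1) refl refl], of f] by simp
  have hit: "paths_in \<Lambda> (0, 2 * int i) t y = paths_in ?A (0, 2 * int i) t y +
      (\<Sum>k<?n. first_hit ?A (0, 2 * int i) (fst (ps ! k)) (snd (ps ! k)) * paths_in \<Lambda> (ps ! k) t y)" for i t y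
    using paths_in_first_hit[OF finite_set ps(2), of "(0, 2 * int i)" t y] by (simp only: reindex)
  have from_start: "(\<Sum>k<a. left_fun (int k) 0 i * right_fun (int k) (fst p) (index p)) = paths_in \<Lambda> (0, 2 * int i) (fst p) (snd p)"
    if "i < a" "p \<in> \<Lambda>" for i p
    using paths_to_point[of 0 i p] that boundary_degrees[of 0 "fst p"] by (simp add: boundary_lines)
  have to_end: "(\<Sum>k<a. left_fun (int k) (fst p) (index p) * right_fun (int k) ?T j) = paths_in \<Lambda> p ?T (last_height j)"
    if "p \<in> \<Lambda>" "j < a" for p j
    using paths_expansion[of "fst p" ?T "index p" j] that pt_index[OF that(1)] boundary_degrees[of "fst p" ?T]
    by (simp add: boundary_lines)
  have start_end: "(\<Sum>k<a. left_fun (int k) 0 i * right_fun (int k) ?T j) = paths_in \<Lambda> (0, 2 * int i) ?T (last_height j)"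
    if "i < a" "j < a" for i j
    using paths_expansion[of 0 ?T i j] that boundary_degrees[of 0 ?T] by (simp add: boundary_lines)
  have UX: "U * end_mat = Matrix.mat ?n a (\<lambda>(i, j). paths_in \<Lambda> (ps ! i) ?T (last_height j))"
    unfolding defs by (intro eq_matI) (auto simp: mult_mat_entry to_end in\<Lambda> simp del: index_mult_mat(1))
  \<comment> \<open>No path inside \<open>?A\<close> ends in a point of \<open>ps\<close>, so all paths from a start point to it have a first hit.\<close>
  have "start_mat * V = F * G"
  proof (rule eq_matI)
    fix i j assume "i < dim_row (F * G)" "j < dim_col (F * G)"
    then have ij: "i < a" "j < ?n" by (auto simp: defs)
    have "ps ! j \<notin> ?A" using ij by simp
    then have "paths_in ?A (0, 2 * int i) (fst (ps ! j)) (snd (ps ! j)) = 0"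
      by (intro paths_in_outside) simp
    then show "(start_mat * V) $$ (i, j) = (F * G) $$ (i, j)"
      unfolding defs using ij hit[of i "fst (ps ! j)" "snd (ps ! j)"]
      by (simp add: mult_mat_entry from_start in\<Lambda> del: index_mult_mat(1))
  qed (auto simp: defs)
  then have "Determinant.det G * Determinant.det (start_mat * end_mat - F * (U * end_mat)) =
      Determinant.det (G - U * V) * Determinant.det start_mat * Determinant.det end_mat"
    by (intro det_bordered[where n = ?n and a = a]) (auto simp: defs)
  moreover have "Determinant.det G = 1"
    unfolding G_def by (rule det_path_counts[OF ps])
  moreover have "start_mat * end_mat - F * (U * end_mat) =
      Matrix.mat a a (\<lambda>(i, j). paths_in ?A (0, 2 * int i) ?T (last_height j))"
    unfolding UX
  proof (rule eq_matI, goal_cases)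
    case (1 i j)
    then have ij: "i < a" "j < a" by auto
    have "(start_mat * end_mat) $$ (i, j) = paths_in \<Lambda> (0, 2 * int i) ?T (last_height j)"
      unfolding defs using ij by (simp add: mult_mat_entry start_end del: index_mult_mat(1))
    moreover have "(F * Matrix.mat ?n a (\<lambda>(i, j). paths_in \<Lambda> (ps ! i) ?T (last_height j))) $$ (i, j) =
        paths_in \<Lambda> (0, 2 * int i) ?T (last_height j) - paths_in ?A (0, 2 * int i) ?T (last_height j)"
      unfolding defs using ij hit[of i ?T "last_height j"] by (simp add: mult_mat_entry del: index_mult_mat(1))
    ultimately show ?case using ij by (simp add: defs del: index_mult_mat(1))
  qed (auto simp: defs)
  moreover have "G - U * V = Matrix.mat ?n ?n
      (\<lambda>(i, j). paths_kernel (fst (ps ! i)) (index (ps ! i)) (fst (ps ! j)) (index (ps ! j)))"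
  proof (rule eq_matI, goal_cases)
    case (1 i j)
    then have ij: "i < ?n" "j < ?n" by auto
    have "pt (fst (ps ! i)) (index (ps ! i)) = ps ! i"
      "alpha_line b (fst (ps ! j)) + 2 * int (index (ps ! j)) = snd (ps ! j)"
      using pt_index(1)[OF in\<Lambda>] ij by (auto simp: pt_def prod_eq_iff)
    moreover have "(U * V) $$ (i, j) = (\<Sum>k<a. left_fun (int k) (fst (ps ! i)) (index (ps ! i)) * right_fun (int k) (fst (ps ! j)) (index (ps ! j)))"
      unfolding U_def V_def using ij by (simp add: mult_mat_entry del: index_mult_mat(1))
    ultimately show ?case using ij
      by (simp add: paths_kernel_def red_degrees G_def U_def V_def del: index_mult_mat(1))
  qed (auto simp: defs)
  ultimately show ?thesis by (simp add: card_walks(2))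
qed

lemma prob_blue:
  assumes ps: "distinct ps" "set ps \<subseteq> \<Lambda>"
  shows "measure_pmf.prob (blue_process a b c) {X. set ps \<subseteq> X} =
    Determinant.det (Matrix.mat (length ps) (length ps)
      (\<lambda>(i, j). paths_kernel (fst (ps ! i)) (index (ps ! i)) (fst (ps ! j)) (index (ps ! j))))"
proof -
  let ?W = "walk_families a b c"
  let ?D = "Determinant.det start_mat * Determinant.det end_mat"
  have W: "?W = walks_to (\<Lambda> - set []) a (b + c) last_height"
    using walks_with_blue_points[of "{}"] by simp
  \<comment> \<open>The empty list of points, whose kernel determinant has size zero and value one.\<close>
  have card: "real (card ?W) = ?D"
    unfolding W by (subst card_walks_avoiding) simp_all
  have nz: "?D \<noteq> 0" using boundary_mats_invertible by simp
  then have fin: "finite ?W" "?W \<noteq> {}"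
    using card card_walks(1) W by (auto simp: card_gt_0_iff)
  have "?W \<inter> blue_dots a b c -` {X. set ps \<subseteq> X} = walks_to (\<Lambda> - set ps) a (b + c) last_height"
    using walks_with_blue_points[OF ps(2)] by auto
  then have "measure_pmf.prob (blue_process a b c) {X. set ps \<subseteq> X} =
      real (card (walks_to (\<Lambda> - set ps) a (b + c) last_height)) / real (card ?W)"
    by (simp add: blue_process_def measure_pmf_of_set fin)
  then show ?thesis
    unfolding card card_walks_avoiding[OF ps] using nz by simp
qed

lemma finite_Lambda: "finite \<Lambda>"
proof -
  have "\<Lambda> = (\<Union>t\<in>{..b + c}. (\<lambda>k. (t, alpha_line b t + 2 * int k)) ` {..\<gamma> t})"
    by (auto simp: Lambda_set_def)
  then show ?thesis by simp
qed

end

theorem theorem5p4: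
  fixes a b c :: nat and K :: "nat \<times> int \<Rightarrow> nat \<times> int \<Rightarrow> real"
  assumes "a > 0" and "b > 0" and "b \<le> c"
    and "\<And>r x s y. r \<le> b + c \<Longrightarrow> x \<le> gamma_line a b c r \<Longrightarrow>
           s \<le> b + c \<Longrightarrow> y \<le> gamma_line a b c s \<Longrightarrow>
           K (r, alpha_line b r + 2 * int x) (s, alpha_line b s + 2 * int y) =
             blue_kernel a b c r x s y"
  shows "determinantal_process (Lambda_set a b c) (blue_process a b c) K"
proof -
  interpret hexagon a b c using assms(1-3) by unfold_locales
  have K: "K p q = paths_kernel (fst p) (index p) (fst q) (index q) * gauge (fst q) (index q) / gauge (fst p) (index p)"
    if pq: "p \<in> \<Lambda>" "q \<in> \<Lambda>" for p q
  proof -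
    have "K p q = K (pt (fst p) (index p)) (pt (fst q) (index q))" by (simp only: pt_index(1) pq)
    also have "\<dots> = blue_kernel a b c (fst p) (index p) (fst q) (index q)"
      unfolding pt_def by (intro assms(4) pt_index pq)
    finally show ?thesis using blue_kernel_eq[OF pt_index(2,3)[OF pq(1)] pt_index(2,3)[OF pq(2)]] by simp
  qed
  show ?thesis
    unfolding determinantal_process_def
  proof (intro conjI allI impI ballI)
    show "finite \<Lambda>" by (rule finite_Lambda)
    show "X \<subseteq> \<Lambda>" if "X \<in> set_pmf (blue_process a b c)" for X
      using that by (auto simp: blue_process_def blue_dots_def)
    fix ps assume "distinct ps \<and> set ps \<subseteq> \<Lambda>"
    then have ps: "distinct ps" "set ps \<subseteq> \<Lambda>" by auto
    let ?n = "length ps"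
    let ?k = "\<lambda>i j. paths_kernel (fst (ps ! i)) (index (ps ! i)) (fst (ps ! j)) (index (ps ! j))"
    let ?g = "\<lambda>i. gauge (fst (ps ! i)) (index (ps ! i))"
    have "Matrix.mat ?n ?n (\<lambda>(i, j). K (ps ! i) (ps ! j)) = Matrix.mat ?n ?n (\<lambda>(i, j). ?k i j * ?g j / ?g i)"
      using ps(2) nth_mem by (intro eq_matI) (auto intro!: K)
    then show "measure_pmf.prob (blue_process a b c) {X. set ps \<subseteq> X} =
        Determinant.det (Matrix.mat ?n ?n (\<lambda>(i, j). K (ps ! i) (ps ! j)))"
      using prob_blue[OF ps] by (simp add: det_conjugate gauge_nonzero)
  qed
qed

end
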